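(* Let $p,q,r>1$, $A>0$, $B>0$, $R\ge 1$, and let $(f,g)\in C_0^2(\mathbf{R})\times C_0^1(\mathbf{R})$ satisfy $\mathrm{supp}\,f,\ \mathrm{supp}\,g\subset\{x\in\mathbf{R}: |x|\le R\}$ and $$\int_{\mathbf{R}}g(x)\,dx\neq 0.$$ Then there exist a positive constant $\varepsilon_1=\varepsilon_1(f,g,p,q,r,A,B,R)>0$ and a positive constant $c$ independent of $\varepsilon$ such that, for every $\varepsilon$ with $0<\varepsilon\le\varepsilon_1$, a classical solution $u\in C^2(\mathbf{R}\times[0,T])$ of the initial value problem $$u_{tt}-u_{xx}=A|u_t|^p|u|^q+B|u|^r,\qquad u(x,0)=\varepsilon f(x),\quad u_t(x,0)=\varepsilon g(x)\quad (x\in\mathbf{R})$$ exists as far as $T>0$ satisfies $$T\le\begin{cases} c\,\varepsilon^{-(p+q-1)} & \text{if } p+q\le\dfrac{r+1}{2},\\[2mm] c\,\varepsilon^{-(r-1)/2} & \text{if } \dfrac{r+1}{2}\le p+q.\end{cases}$$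
   Context: $C_0^k(\mathbf{R})$ denotes the real-valued $C^k$ functions on $\mathbf{R}$ with compact support. A classical solution in the time interval $[0,T]$ is a real-valued function $u\in C^2(\mathbf{R}\times[0,T])$ satisfying the equation and the initial conditions pointwise. The space dimension is one. *)

theory Defs
  imports "HOL-Analysis.Analysis"
begin

definition Ck :: "nat \<Rightarrow> (real \<Rightarrow> real) \<Rightarrow> bool" where
  "Ck k f \<longleftrightarrow>
     (\<forall>j<k. \<forall>x. (deriv ^^ j) f differentiable (at x)) \<and>
     (\<forall>j\<le>k. continuous_on UNIV ((deriv ^^ j) f))"

definition supp :: "(real \<Rightarrow> real) \<Rightarrow> real set" where
  "supp f = closure {x. f x \<noteq> 0}"

definition C0k :: "nat \<Rightarrow> (real \<Rightarrow> real) \<Rightarrow> bool" where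
  "C0k k f \<longleftrightarrow> Ck k f \<and> compact (supp f)"

definition strip :: "real \<Rightarrow> (real \<times> real) set" where
  "strip T = UNIV \<times> {0..T}"

text \<open>
  Functions on the strip are total functions of the pair \<open>(x, t)\<close>; only their values for
  \<open>0 \<le> t \<le> T\<close> matter. The time derivative is taken within \<open>[0, T]\<close>, hence is one-sided at
  \<open>t = 0\<close> and \<open>t = T\<close> (and meaningful only for \<open>T > 0\<close>).
\<close>

definition dx :: "(real \<times> real \<Rightarrow> real) \<Rightarrow> (real \<times> real \<Rightarrow> real)" where
  "dx u = (\<lambda>(x, t). deriv (\<lambda>y. u (y, t)) x)"

definition dt :: "real \<Rightarrow> (real \<times> real \<Rightarrow> real) \<Rightarrow> (real \<times> real \<Rightarrow> real)" where
  "dt T u = (\<lambda>(x, t). vector_derivative (\<lambda>s. u (x, s)) (at t within {0..T}))"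

text \<open>
  \<open>C\<^sup>k\<close> on the closed strip: all partial derivatives up to order \<open>k\<close>, in any order of
  differentiation, exist and are continuous on the strip, including its boundary lines.
\<close>

primrec Ck_strip :: "nat \<Rightarrow> real \<Rightarrow> (real \<times> real \<Rightarrow> real) \<Rightarrow> bool" where
  "Ck_strip 0 T u \<longleftrightarrow> continuous_on (strip T) u"
| "Ck_strip (Suc k) T u \<longleftrightarrow>
     continuous_on (strip T) u \<and>
     (\<forall>(x, t) \<in> strip T.
        (\<lambda>y. u (y, t)) differentiable (at x) \<and>
        (\<lambda>s. u (x, s)) differentiable (at t within {0..T})) \<and>
     Ck_strip k T (dx u) \<and> Ck_strip k T (dt T u)"

text \<open>
  Note \<open>0 powr a = 0\<close>, so \<open>\<bar>y\<bar> powr a\<close> is the usual power of \<open>\<bar>y\<bar>\<close> for \<open>a > 0\<close>.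
\<close>

definition classical_solution ::
  "real \<Rightarrow> real \<Rightarrow> real \<Rightarrow> real \<Rightarrow> real \<Rightarrow> (real \<Rightarrow> real) \<Rightarrow> (real \<Rightarrow> real) \<Rightarrow> real \<Rightarrow> real
    \<Rightarrow> (real \<times> real \<Rightarrow> real) \<Rightarrow> bool" where
  "classical_solution p q r A B f g \<epsilon> T u \<longleftrightarrow>
     Ck_strip 2 T u \<and>
     (\<forall>z \<in> strip T.
        dt T (dt T u) z - dx (dx u) z =
          A * \<bar>dt T u z\<bar> powr p * \<bar>u z\<bar> powr q + B * \<bar>u z\<bar> powr r) \<and>
     (\<forall>x. u (x, 0) = \<epsilon> * f x \<and> dt T u (x, 0) = \<epsilon> * g x)"

end

theory Submission
  imports Defs
begin

text \<open>
  Everything is expressed through the velocity \<open>v = u\<^sub>t\<close>. Since \<open>u = \<epsilon> f + \<integral> v dt\<close>, the Cauchy problem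
  is equivalent to one fixed-point equation for \<open>v\<close>: half of the data travelling along the two
  characteristics, plus half of the integrals of the nonlinearity along the two backward
  characteristics (D'Alembert's and Duhamel's formulas, differentiated in \<open>t\<close>).

  \<^emph>\<open>Why the solution lives so long.\<close> Let \<open>m\<close> be the minimum of \<open>p + q\<close> and \<open>(r + 1) / 2\<close>, so that both
  cases of the lifespan bound read \<open>T \<le> c \<epsilon>\<^bsup>1 - m\<^esup>\<close>. A uniform bound \<open>\<bar>v\<bar> \<lesssim> \<epsilon>\<close> would be too weak:
  integrated over a time \<open>T\<close>, it does not even keep \<open>u\<close> of size \<open>\<epsilon>\<close>. But free
  waves obey Huygens' principle for the velocity: the data term vanishes unless
  \<open>\<bar>\<bar>x\<bar> - t\<bar> \<le> R\<close>. Hence the ansatz \<open>\<bar>v\<bar> \<le> M \<epsilon>\<close> near the cone and \<open>\<bar>v\<bar> \<le> K \<epsilon>\<^bsup>m\<^esup>\<close> off it. It gives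
  \<open>\<bar>u\<bar> \<le> N \<epsilon>\<close>, as a vertical line stays near the cone for a time at most \<open>2 R\<close> and
  \<open>T \<epsilon>\<^bsup>m\<^esup> \<le> c \<epsilon>\<close>. A characteristic through a point off the cone crosses the neighbourhood of the cone
  in a time at most \<open>R\<close>, so that the large part \<open>\<epsilon>\<^bsup>p + q\<^esup>\<close> of the nonlinearity contributes
  only \<open>R \<epsilon>\<^bsup>p + q\<^esup>\<close> there and at most \<open>T \<epsilon>\<^bsup>p + q\<^esup> \<le> c \<epsilon>\<close> near the cone; the rest contributes at most
  \<open>T (\<epsilon>\<^bsup>p m + q\<^esup> + \<epsilon>\<^bsup>r\<^esup>)\<close>. The inequalities \<open>m \<le> p + q\<close>, \<open>2 m - 1 \<le> r\<close> and \<open>(p - 1) (m - 1) \<ge> 0\<close> are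
  exactly what makes the ansatz reproduce itself for small \<open>c\<close>
  (\<open>bootstrap_constants\<close>, \<open>velocity_preserves_cone_weight\<close>).

  \<^emph>\<open>Why a solution exists.\<close> Smallness is needed only for that self-mapping property. On the functions
  satisfying the ansatz the nonlinearity is Lipschitz and the integral operator is of Volterra type,
  so it halves distances in the norm weighted by \<open>exp (- \<mu> t)\<close> once \<open>\<mu>\<close> is large, whatever \<open>T\<close> is, and
  the Picard iterates \<open>v\<^sub>n\<close> converge.

  \<^emph>\<open>Why it is of class \<open>C\<^sup>2\<close>.\<close> The coefficients of the equation solved by \<open>\<partial>\<^sub>x v\<close> are first derivatives of
  the nonlinearity, which are continuous but in general not Lipschitz, so that the \<open>\<partial>\<^sub>x v\<^sub>n\<close> need not contract.
  They do contract up to an error that vanishes because the coefficients at \<open>v\<^sub>n\<close>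
  converge uniformly, and this suffices for uniform convergence
  (\<open>uniformly_convergent_on_asymptotic_contraction\<close>). Thus \<open>v\<close> is \<open>C\<^sup>1\<close> in \<open>x\<close>; all
  derivatives of \<open>u\<close> up to second order are then read off the characteristic representation
  (\<open>fixed_point_is_classical\<close>).
\<close>

section \<open>Integration along characteristics\<close>

text \<open>
  The solution of \<open>(\<partial>\<^sub>t - \<sigma> \<partial>\<^sub>x) a = G\<close> with zero initial value. The speeds \<open>\<sigma> = 1\<close> and \<open>\<sigma> = - 1\<close>
  give the two families of characteristics of the wave equation; \<open>\<sigma> = 0\<close> is plain
  integration in time.
\<close>
definition transport :: "real \<Rightarrow> (real \<times> real \<Rightarrow> real) \<Rightarrow> real \<times> real \<Rightarrow> real" where
  "transport \<sigma> G = (\<lambda>(x, t). integral {0..t} (\<lambda>s. G (x + \<sigma> * (t - s), s)))"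

lemma transport_path_continuous:
  fixes G :: "real \<times> real \<Rightarrow> real"
  assumes G: "continuous_on (strip T) G" and t: "t \<le> T"
  shows "continuous_on {0..t} (\<lambda>s. G (x + \<sigma> * (t - s), s))"
  by (rule continuous_on_compose2[OF G])
    (use t in \<open>auto intro!: continuous_intros simp: strip_def\<close>)

lemma transport_path_integrable:
  fixes G :: "real \<times> real \<Rightarrow> real"
  assumes "continuous_on (strip T) G" and "t \<le> T"
  shows "(\<lambda>s. G (x + \<sigma> * (t - s), s)) integrable_on {0..t}"
  by (rule integrable_continuous_real[OF transport_path_continuous[OF assms]])

text \<open>A fixed domain of integration makes continuity in \<open>(x, t)\<close> jointly a parameter-integral statement.\<close>
lemma transport_rescaled:
  assumes t: "0 \<le> t"
  shows "transport \<sigma> G (x, t)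
    = t * integral {0..1} (\<lambda>\<tau>. G (x + \<sigma> * (t - t * \<tau>), t * \<tau>))"
proof (cases "t = 0")
  case False
  with t have t: "t > 0" by simp
  have "(\<lambda>\<tau>. \<tau> / t) ` {0..t} = {0..1}"
    using t by (auto simp: image_iff field_simps intro!: bexI[of _ "t * _"])
  with integral_stretch_real[of t 0 t "\<lambda>s. G (x + \<sigma> * (t - s), s)"] t show ?thesis
    by (simp add: transport_def)
qed (simp add: transport_def)

lemma transport_continuous:
  assumes G: "continuous_on (strip T) G"
  shows "continuous_on (strip T) (transport \<sigma> G)"
proof -
  have "continuous_on (strip T \<times> cbox 0 (1::real))
    (\<lambda>(z, \<tau>). G (fst z + \<sigma> * (snd z - snd z * \<tau>), snd z * \<tau>))"
    unfolding split_beta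
    by (rule continuous_on_compose2[OF G])
      (auto intro!: continuous_intros mult_le_one simp: strip_def
        intro: order_trans[OF mult_left_le])
  from integral_continuous_on_param[OF this]
  have "continuous_on (strip T) (\<lambda>z. snd z *
      integral {0..1} (\<lambda>\<tau>. G (fst z + \<sigma> * (snd z - snd z * \<tau>), snd z * \<tau>)))"
    by (auto intro!: continuous_intros)
  then show ?thesis
    by (rule continuous_on_eq) (auto simp: strip_def transport_rescaled)
qed

lemma transport_diff:
  assumes "continuous_on (strip T) G" "continuous_on (strip T) G'" and "t \<le> T"
  shows "transport \<sigma> G (x, t) - transport \<sigma> G' (x, t) = transport \<sigma> (\<lambda>z. G z - G' z) (x, t)"
  using assms by (simp add: transport_def integral_diff transport_path_integrable)

text \<open>
  The gain \<open>1 / \<mu>\<close> is what turns every Volterra operator below into a contraction on an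
  arbitrarily long time interval.
\<close>
lemma transport_exp_bound:
  assumes G: "continuous_on (strip T) G" and \<mu>: "\<mu> > 0" and z: "z \<in> strip T"
    and le: "\<And>z. z \<in> strip T \<Longrightarrow> \<bar>G z\<bar> \<le> k * exp (\<mu> * snd z)"
  shows "\<bar>transport \<sigma> G z\<bar> \<le> k / \<mu> * exp (\<mu> * snd z)"
proof -
  obtain x t where z_eq: "z = (x, t)" and t: "0 \<le> t" "t \<le> T"
    using z by (auto simp: strip_def)
  have k: "0 \<le> k"
    using le[OF z] abs_ge_zero order_trans zero_le_mult_iff[of k "exp (\<mu> * snd z)"]
    by (metis exp_gt_zero not_le)
  have I: "((\<lambda>s. k * exp (\<mu> * s)) has_integral k / \<mu> * exp (\<mu> * t) - k / \<mu> * exp (\<mu> * 0)) {0..t}"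
    using t \<mu> by (intro fundamental_theorem_of_calculus)
      (auto intro!: derivative_eq_intros
        simp flip: has_real_derivative_iff_has_vector_derivative)
  have "\<bar>transport \<sigma> G (x, t)\<bar> \<le> integral {0..t} (\<lambda>s. k * exp (\<mu> * s))"
    unfolding transport_def split_conv real_norm_def[symmetric]
    using t le I
    by (intro integral_norm_bound_integral transport_path_integrable[OF G])
      (auto simp: strip_def has_integral_iff)
  also have "\<dots> \<le> k / \<mu> * exp (\<mu> * t)"
    using I k \<mu> by (simp add: has_integral_iff)
  finally show ?thesis by (simp add: z_eq)
qed

text \<open>
  Time derivatives never enter the iteration: they are supplied by the equation, so control
  of one spatial derivative is the right regularity class.
\<close>
definition C1_in_x :: "real \<Rightarrow> (real \<times> real \<Rightarrow> real) \<Rightarrow> (real \<times> real \<Rightarrow> real) \<Rightarrow> bool" where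
  "C1_in_x T G G' \<longleftrightarrow> continuous_on (strip T) G \<and> continuous_on (strip T) G' \<and>
    (\<forall>x. \<forall>t\<in>{0..T}. ((\<lambda>y. G (y, t)) has_real_derivative G' (x, t)) (at x))"

lemma C1_in_x_transport:
  assumes "C1_in_x T G G'"
  shows "C1_in_x T (transport \<sigma> G) (transport \<sigma> G')"
proof -
  have G: "continuous_on (strip T) G" and G': "continuous_on (strip T) G'"
    and D: "\<And>x t. t \<in> {0..T} \<Longrightarrow> ((\<lambda>y. G (y, t)) has_real_derivative G' (x, t)) (at x)"
    using assms by (auto simp: C1_in_x_def)
  have "((\<lambda>y. integral {0..t} (\<lambda>s. G (y + \<sigma> * (t - s), s)))
      has_real_derivative integral {0..t} (\<lambda>s. G' (x + \<sigma> * (t - s), s))) (at x)"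
    if t: "t \<in> {0..T}" for x t
  proof -
    have "continuous_on (UNIV \<times> cbox 0 t) (\<lambda>(y, s). G' (y + \<sigma> * (t - s), s))"
      unfolding split_beta
      by (rule continuous_on_compose2[OF G'])
        (use t in \<open>auto intro!: continuous_intros simp: strip_def\<close>)
    moreover have "((\<lambda>y. G (y + \<sigma> * (t - s), s)) has_real_derivative
        G' (y + \<sigma> * (t - s), s)) (at y)" if "s \<in> cbox 0 t" for y s
      using DERIV_shift[of "\<lambda>y. G (y, s)" _ y "\<sigma> * (t - s)"] D[of s "y + \<sigma> * (t - s)"] that t
      by (simp add: add.commute)
    ultimately show ?thesis
      using leibniz_rule_field_derivative[of UNIV 0 t "\<lambda>y s. G (y + \<sigma> * (t - s), s)"
          "\<lambda>y s. G' (y + \<sigma> * (t - s), s)" x] t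
        transport_path_integrable[OF G, of t _ \<sigma>]
      by auto
  qed
  with G G' show ?thesis
    by (simp add: C1_in_x_def transport_continuous) (simp add: transport_def)
qed

text \<open>
  In the coordinate \<open>y = x + \<sigma> t\<close>, constant along the characteristics, the integrand no longer depends on
  the endpoint \<open>t\<close>. There the integral has continuous partial derivatives, hence a total one, and
  the chain rule along \<open>t \<mapsto> (x + \<sigma> t, t)\<close> brings it back.
\<close>
lemma transport_time_derivative:
  assumes C1: "C1_in_x T G G'" and t: "t \<in> {0..T}"
  shows "((\<lambda>s. transport \<sigma> G (x, s)) has_real_derivative
    G (x, t) + \<sigma> * transport \<sigma> G' (x, t)) (at t within {0..T})"
proof -
  \<comment> \<open>\<open>G\<close> in the coordinates \<open>(y, t)\<close>, where transport is integration in time, that is, speed \<open>0\<close>\<close>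
  define K where "K = (\<lambda>z. G (fst z - \<sigma> * snd z, snd z))"
  define K' where "K' = (\<lambda>z. G' (fst z - \<sigma> * snd z, snd z))"
  have G: "continuous_on (strip T) G" and G': "continuous_on (strip T) G'"
    and D: "\<And>x t. t \<in> {0..T} \<Longrightarrow> ((\<lambda>y. G (y, t)) has_real_derivative G' (x, t)) (at x)"
    using C1 by (auto simp: C1_in_x_def)
  have K: "continuous_on (strip T) K" and K': "continuous_on (strip T) K'"
    unfolding K_def K'_def
    by (rule continuous_on_compose2[OF G] continuous_on_compose2[OF G'];
        auto intro!: continuous_intros simp: strip_def)+
  have DK: "((\<lambda>y. K (y, s)) has_real_derivative K' (y, s)) (at y)" if "s \<in> {0..T}" for y s
    using DERIV_shift[of "\<lambda>y. G (y, s)" _ y "- \<sigma> * s"] D[of s "y - \<sigma> * s"] that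
    by (simp add: K_def K'_def)
  then have "C1_in_x T K K'" using K K' by (simp add: C1_in_x_def)
  from C1_in_x_transport[OF this, of 0] t
  have fst_partial: "((\<lambda>y. transport 0 K (y, t)) has_derivative (\<lambda>h. transport 0 K' (x + \<sigma> * t, t) * h))
      (at (x + \<sigma> * t) within UNIV)"
    by (auto simp: C1_in_x_def has_field_derivative_def)
  have snd_partial: "((\<lambda>s. transport 0 K (y, s)) has_derivative blinfun_mult_right (K (y, s)))
      (at s within {0..T})" if "s \<in> {0..T}" for y s
    using integral_has_real_derivative[OF transport_path_continuous[OF K order_refl, of y 0] that]
    by (simp add: transport_def has_field_derivative_def)
  have "continuous_on (UNIV \<times> {0..T}) (\<lambda>(y, s). blinfun_mult_right (K (y, s)))"
    unfolding split_beta using K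
    by (auto intro!: continuous_intros simp: strip_def)
  then have "continuous (at (x + \<sigma> * t, t) within UNIV \<times> {0..T}) (\<lambda>(y, s). blinfun_mult_right (K (y, s)))"
    using t by (auto simp: continuous_on_eq_continuous_within split_beta')
  from has_derivative_partialsI[OF fst_partial snd_partial this t]
  have total: "(transport 0 K has_derivative
      (\<lambda>(h, k). transport 0 K' (x + \<sigma> * t, t) * h + K (x + \<sigma> * t, t) * k))
      (at (x + \<sigma> * t, t) within UNIV \<times> {0..T})"
    by simp
  have "((\<lambda>s. transport 0 K (x + \<sigma> * s, s)) has_derivative
      (\<lambda>k. transport 0 K' (x + \<sigma> * t, t) * (\<sigma> * k) + K (x + \<sigma> * t, t) * k)) (at t within {0..T})"
    by (rule has_derivative_in_compose[where g = "transport 0 K" and f = "\<lambda>s. (x + \<sigma> * s, s)",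
          OF _ has_derivative_subset[OF total], THEN has_derivative_eq_rhs])
      (auto intro!: derivative_eq_intros)
  moreover have "transport 0 K (x + \<sigma> * s, s) = transport \<sigma> G (x, s)"
    "transport 0 K' (x + \<sigma> * s, s) = transport \<sigma> G' (x, s)" for s
    by (simp_all add: transport_def K_def K'_def algebra_simps)
  moreover have "K (x + \<sigma> * t, t) = G (x, t)" by (simp add: K_def)
  ultimately have "((\<lambda>s. transport \<sigma> G (x, s)) has_derivative
      (\<lambda>k. transport \<sigma> G' (x, t) * (\<sigma> * k) + G (x, t) * k)) (at t within {0..T})"
    by simp
  then show ?thesis
    unfolding has_field_derivative_def
    by (rule has_derivative_eq_rhs) (auto simp: algebra_simps)
qed

section \<open>D'Alembert's formula\<close>

text \<open>
  Half the sum of the two Riemann invariants: the velocity of the wave with source \<open>S\<close> and with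
  \<open>u\<^sub>t + u\<^sub>x = \<phi>\<close> and \<open>u\<^sub>t - u\<^sub>x = \<psi>\<close> at time \<open>0\<close>.
\<close>
definition dalembert :: "(real \<Rightarrow> real) \<Rightarrow> (real \<Rightarrow> real) \<Rightarrow> (real \<times> real \<Rightarrow> real) \<Rightarrow> real \<times> real \<Rightarrow> real" where
  "dalembert \<phi> \<psi> S = (\<lambda>z. (\<phi> (fst z + snd z) + \<psi> (fst z - snd z)
    + transport 1 S z + transport (- 1) S z) / 2)"

lemma dalembert_continuous:
  assumes "continuous_on (strip T) S" "continuous_on UNIV \<phi>" "continuous_on UNIV \<psi>"
  shows "continuous_on (strip T) (dalembert \<phi> \<psi> S)"
  unfolding dalembert_def
  by (intro continuous_intros transport_continuous assms
      continuous_on_compose2[OF assms(2)] continuous_on_compose2[OF assms(3)]) auto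

lemma C1_in_x_dalembert:
  assumes S: "C1_in_x T S S'"
    and "\<And>x. (\<phi> has_real_derivative \<phi>' x) (at x)" "\<And>x. (\<psi> has_real_derivative \<psi>' x) (at x)"
    and "continuous_on UNIV \<phi>'" "continuous_on UNIV \<psi>'"
  shows "C1_in_x T (dalembert \<phi> \<psi> S) (dalembert \<phi>' \<psi>' S')"
proof -
  have "continuous_on UNIV \<phi>" "continuous_on UNIV \<psi>"
    using assms(2,3) by (auto intro!: DERIV_isCont continuous_at_imp_continuous_on)
  moreover have "((\<lambda>y. dalembert \<phi> \<psi> S (y, t)) has_real_derivative dalembert \<phi>' \<psi>' S' (x, t)) (at x)"
    if t: "t \<in> {0..T}" for x t
  proof -
    have "((\<lambda>y. \<phi> (y + t)) has_real_derivative \<phi>' (x + t)) (at x)"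
      "((\<lambda>y. \<psi> (y - t)) has_real_derivative \<psi>' (x - t)) (at x)"
      using DERIV_shift[of \<phi> _ x t] DERIV_shift[of \<psi> _ x "- t"] assms(2,3) by auto
    moreover have "((\<lambda>y. transport \<sigma> S (y, t)) has_real_derivative transport \<sigma> S' (x, t)) (at x)" for \<sigma>
      using C1_in_x_transport[OF S, of \<sigma>] t by (simp add: C1_in_x_def)
    ultimately show ?thesis
      unfolding dalembert_def fst_conv snd_conv
      by (intro DERIV_cdivide DERIV_add)
  qed
  ultimately show ?thesis
    using S assms(4,5) by (auto simp: C1_in_x_def intro!: dalembert_continuous)
qed

lemma dalembert_time_derivative:
  assumes S: "C1_in_x T S S'" and t: "t \<in> {0..T}"
    and "\<And>x. (\<phi> has_real_derivative \<phi>' x) (at x)" "\<And>x. (\<psi> has_real_derivative \<psi>' x) (at x)"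
  shows "((\<lambda>s. dalembert \<phi> \<psi> S (x, s)) has_real_derivative
    S (x, t) + (\<phi>' (x + t) - \<psi>' (x - t) + transport 1 S' (x, t) - transport (- 1) S' (x, t)) / 2)
    (at t within {0..T})"
proof -
  have "((\<lambda>s. \<phi> (x + s)) has_real_derivative \<phi>' (x + t)) (at t within {0..T})"
    using DERIV_shift[of \<phi> _ t x] assms(3)[of "x + t"]
    by (auto simp: add.commute intro: has_field_derivative_at_within)
  moreover have "((\<lambda>s. x - s) has_real_derivative - 1) (at t)"
    by (auto intro!: derivative_eq_intros)
  from DERIV_chain2[OF assms(4)[of "x - t"] this]
  have "((\<lambda>s. \<psi> (x - s)) has_real_derivative - \<psi>' (x - t)) (at t within {0..T})"
    by (auto intro: has_field_derivative_at_within)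
  ultimately have "((\<lambda>s. dalembert \<phi> \<psi> S (x, s)) has_real_derivative
    (\<phi>' (x + t) + - \<psi>' (x - t) + (S (x, t) + 1 * transport 1 S' (x, t))
      + (S (x, t) + - 1 * transport (- 1) S' (x, t))) / 2) (at t within {0..T})"
    unfolding dalembert_def fst_conv snd_conv
    by (intro DERIV_cdivide DERIV_add transport_time_derivative[OF S t])
  then show ?thesis
    by (rule DERIV_cong) (simp add: field_simps)
qed

lemma dalembert_exp_diff:
  assumes S: "continuous_on (strip T) S" "continuous_on (strip T) S'"
    and \<mu>: "\<mu> > 0" and z: "z \<in> strip T"
    and le: "\<And>z. z \<in> strip T \<Longrightarrow> \<bar>S z - S' z\<bar> \<le> k * exp (\<mu> * snd z)"
  shows "\<bar>dalembert \<phi> \<psi> S z - dalembert \<phi> \<psi> S' z\<bar> \<le> k / \<mu> * exp (\<mu> * snd z)"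
proof -
  have "\<bar>transport \<sigma> S z - transport \<sigma> S' z\<bar> \<le> k / \<mu> * exp (\<mu> * snd z)" for \<sigma>
    using transport_exp_bound[OF continuous_on_diff[OF S] \<mu> z le, of \<sigma>]
      transport_diff[OF S, of "snd z" \<sigma> "fst z"] z
    by (auto simp: strip_def)
  moreover have "\<bar>(a + b + c + d) / 2 - (a + b + c' + d') / 2\<bar> \<le> e"
    if "\<bar>c - c'\<bar> \<le> e" "\<bar>d - d'\<bar> \<le> e" for a b c d c' d' e :: real
    using that by argo
  ultimately show ?thesis unfolding dalembert_def by blast
qed

lemma dalembert_exp_bound:
  assumes S: "continuous_on (strip T) S"
    and \<mu>: "\<mu> > 0" and z: "z \<in> strip T"
    and "\<And>x. \<bar>\<phi> x\<bar> \<le> D" "\<And>x. \<bar>\<psi> x\<bar> \<le> D"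
    and le: "\<And>z. z \<in> strip T \<Longrightarrow> \<bar>S z\<bar> \<le> k * exp (\<mu> * snd z)"
  shows "\<bar>dalembert \<phi> \<psi> S z\<bar> \<le> D + k / \<mu> * exp (\<mu> * snd z)"
proof -
  have "\<bar>transport \<sigma> S z\<bar> \<le> k / \<mu> * exp (\<mu> * snd z)" for \<sigma>
    by (rule transport_exp_bound[OF S \<mu> z le])
  moreover have "\<bar>(a + b + c + d) / 2\<bar> \<le> D + e"
    if "\<bar>a\<bar> \<le> D" "\<bar>b\<bar> \<le> D" "\<bar>c\<bar> \<le> e" "\<bar>d\<bar> \<le> e" for a b c d e :: real
    using that by argo
  ultimately show ?thesis using assms(4,5) unfolding dalembert_def by blast
qed

section \<open>Partial derivatives on the strip\<close>

lemma dx_eq: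
  assumes "C1_in_x T u u'" and "z \<in> strip T"
  shows "dx u z = u' z"
  using assms by (auto simp: C1_in_x_def strip_def dx_def DERIV_imp_deriv)

lemma dt_eq:
  assumes "0 < T" and "t \<in> {0..T}"
    and "((\<lambda>s. u (x, s)) has_real_derivative d) (at t within {0..T})"
  shows "dt T u (x, t) = d"
  using vector_derivative_within_cbox[of 0 T t "\<lambda>s. u (x, s)" d] assms
  by (simp add: dt_def has_real_derivative_iff_has_vector_derivative)

text \<open>
  The partial derivatives at points of the strip depend only on the values there, so
  regularity may be checked with any functions that agree with them on the strip.
\<close>
lemma has_vector_derivative_strip_cong:
  assumes "\<forall>z\<in>strip T. u z = u' z" and "t \<in> {0..T}"
  shows "((\<lambda>s. u (x, s)) has_vector_derivative d) (at t within {0..T}) \<longleftrightarrow>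
    ((\<lambda>s. u' (x, s)) has_vector_derivative d) (at t within {0..T})"
  using assms
  by (intro iffI; elim has_vector_derivative_transform[rotated 2]) (auto simp: strip_def)

lemma dx_cong:
  assumes "\<forall>z\<in>strip T. u z = u' z" and "z \<in> strip T"
  shows "dx u z = dx u' z"
  using assms by (auto simp: strip_def dx_def)

lemma dt_cong:
  assumes "\<forall>z\<in>strip T. u z = u' z" and "z \<in> strip T"
  shows "dt T u z = dt T u' z"
  using assms(2) has_vector_derivative_strip_cong[OF assms(1)]
  by (auto simp: strip_def dt_def vector_derivative_def)

lemma Ck_strip_cong:
  assumes "\<forall>z\<in>strip T. u z = u' z"
  shows "Ck_strip k T u \<longleftrightarrow> Ck_strip k T u'"
  using assms
proof (induction k arbitrary: u u')
  case 0
  then show ?case by (auto cong: continuous_on_cong)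
next
  case (Suc k)
  have 1: "continuous_on (strip T) u \<longleftrightarrow> continuous_on (strip T) u'"
    using Suc.prems by (auto cong: continuous_on_cong)
  have 2: "(\<lambda>s. u (x, s)) differentiable (at t within {0..T}) \<longleftrightarrow>
      (\<lambda>s. u' (x, s)) differentiable (at t within {0..T})" if "(x, t) \<in> strip T" for x t
    using has_vector_derivative_strip_cong[OF Suc.prems, of t x] that
    unfolding real_differentiable_def has_real_derivative_iff_has_vector_derivative strip_def
    by blast
  have 3: "(\<lambda>y. u (y, t)) = (\<lambda>y. u' (y, t))" if "(x, t) \<in> strip T" for x t
    using Suc.prems that by (auto simp: strip_def)
  have "Ck_strip k T (dx u) \<longleftrightarrow> Ck_strip k T (dx u')"
    using Suc.prems dx_cong by (intro Suc.IH) blast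
  moreover have "Ck_strip k T (dt T u) \<longleftrightarrow> Ck_strip k T (dt T u')"
    using Suc.prems dt_cong by (intro Suc.IH) blast
  ultimately show ?case
    unfolding Ck_strip.simps
    by (intro conj_cong ball_cong refl 1) (use 2 3 in auto)
qed

lemma C1_strip_criterion:
  assumes T: "0 < T" and u: "C1_in_x T u ux"
    and u_t: "\<And>x t. t \<in> {0..T} \<Longrightarrow>
      ((\<lambda>s. u (x, s)) has_real_derivative ut (x, t)) (at t within {0..T})"
    and ut: "continuous_on (strip T) ut"
  shows "Ck_strip (Suc 0) T u"
    and "\<forall>z\<in>strip T. dx u z = ux z" and "\<forall>z\<in>strip T. dt T u z = ut z"
proof -
  show dxu: "\<forall>z\<in>strip T. dx u z = ux z" using dx_eq[OF u] by blast
  show dtu: "\<forall>z\<in>strip T. dt T u z = ut z"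
    using dt_eq[where u = u, OF T] u_t by (auto simp: strip_def)
  have "continuous_on (strip T) (dx u)" "continuous_on (strip T) (dt T u)"
    using u ut dxu dtu by (auto simp: C1_in_x_def cong: continuous_on_cong)
  then show "Ck_strip (Suc 0) T u"
    using u u_t unfolding Ck_strip.simps C1_in_x_def strip_def real_differentiable_def
    by fastforce
qed

text \<open>
  The mixed derivatives \<open>uxt\<close> and \<open>utx\<close> are separate data, as both orders of differentiation have
  to be continuous.
\<close>
lemma C2_strip_criterion:
  assumes T: "0 < T"
    and u: "C1_in_x T u ux" and ux: "C1_in_x T ux uxx" and ut: "C1_in_x T ut utx"
    and u_t: "\<And>x t. t \<in> {0..T} \<Longrightarrow>
      ((\<lambda>s. u (x, s)) has_real_derivative ut (x, t)) (at t within {0..T})"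
    and ux_t: "\<And>x t. t \<in> {0..T} \<Longrightarrow>
      ((\<lambda>s. ux (x, s)) has_real_derivative uxt (x, t)) (at t within {0..T})"
    and ut_t: "\<And>x t. t \<in> {0..T} \<Longrightarrow>
      ((\<lambda>s. ut (x, s)) has_real_derivative utt (x, t)) (at t within {0..T})"
    and cont: "continuous_on (strip T) uxt" "continuous_on (strip T) utt"
  shows "Ck_strip 2 T u"
    and "\<forall>z\<in>strip T. dt T u z = ut z"
    and "\<forall>z\<in>strip T. dt T (dt T u) z = utt z"
    and "\<forall>z\<in>strip T. dx (dx u) z = uxx z"
proof -
  have "continuous_on (strip T) ut" using ut by (simp add: C1_in_x_def)
  note 1 = C1_strip_criterion[OF T u u_t this]
    and 2 = C1_strip_criterion[OF T ux ux_t cont(1)]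
    and 3 = C1_strip_criterion[OF T ut ut_t cont(2)]
  show "\<forall>z\<in>strip T. dt T u z = ut z" by (rule 1(3))
  show "\<forall>z\<in>strip T. dt T (dt T u) z = utt z"
    using dt_cong[OF 1(3)] 3(3) by simp
  show "\<forall>z\<in>strip T. dx (dx u) z = uxx z"
    using dx_cong[OF 1(2)] 2(2) by simp
  have "Ck_strip (Suc 0) T (dx u)" "Ck_strip (Suc 0) T (dt T u)"
    using Ck_strip_cong[OF 1(2), of "Suc 0"] Ck_strip_cong[OF 1(3), of "Suc 0"] 2(1) 3(1) by simp_all
  with 1(1) show "Ck_strip 2 T u"
    by (simp add: numeral_2_eq_2)
qed

section \<open>The fixed-point equation for the velocity\<close>

text \<open>
  The problem \<open>u\<^sub>t\<^sub>t - u\<^sub>x\<^sub>x = F (u\<^sub>t, u)\<close>, \<open>u = h\<close> at time \<open>0\<close>, with a \<open>C\<^sup>1\<close> nonlinearity of partial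
  derivatives \<open>Fv\<close>, \<open>Fu\<close>. The data enter through the initial Riemann invariants \<open>\<phi> = u\<^sub>t + u\<^sub>x\<close> and
  \<open>\<psi> = u\<^sub>t - u\<^sub>x\<close>, whose difference is tied to \<open>h\<close>.
\<close>
locale semilinear_wave =
  fixes T D :: real and F Fv Fu :: "real \<times> real \<Rightarrow> real"
    and h h' \<phi> \<phi>' \<psi> \<psi>' :: "real \<Rightarrow> real"
  assumes T: "0 < T"
    and F: "\<And>z. (F has_derivative (\<lambda>d. Fv z * fst d + Fu z * snd d)) (at z)"
    and Fv_Fu_continuous: "continuous_on UNIV Fv" "continuous_on UNIV Fu"
    and data_derivatives: "\<And>x. (h has_real_derivative h' x) (at x)"
      "\<And>x. (\<phi> has_real_derivative \<phi>' x) (at x)" "\<And>x. (\<psi> has_real_derivative \<psi>' x) (at x)"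
    and data_continuous: "continuous_on UNIV h'" "continuous_on UNIV \<phi>'" "continuous_on UNIV \<psi>'"
    and data_bounds: "\<And>x. \<bar>h x\<bar> \<le> D" "\<And>x. \<bar>h' x\<bar> \<le> D" "\<And>x. \<bar>\<phi>' x\<bar> \<le> D" "\<And>x. \<bar>\<psi>' x\<bar> \<le> D"
    and compatible: "\<And>x. \<phi> x - \<psi> x = 2 * h' x"
begin

definition displacement :: "(real \<times> real \<Rightarrow> real) \<Rightarrow> real \<times> real \<Rightarrow> real" where
  "displacement v = (\<lambda>z. h (fst z) + transport 0 v z)"

text \<open>
  The functions with suffix \<open>_x\<close> are the formal spatial derivatives, with \<open>w\<close> in the
  place of \<open>\<partial>\<^sub>x v\<close>; they make sense before \<open>v\<close> is known to be differentiable.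
\<close>
definition displacement_x :: "(real \<times> real \<Rightarrow> real) \<Rightarrow> real \<times> real \<Rightarrow> real" where
  "displacement_x w = (\<lambda>z. h' (fst z) + transport 0 w z)"

definition source :: "(real \<times> real \<Rightarrow> real) \<Rightarrow> real \<times> real \<Rightarrow> real" where
  "source v = (\<lambda>z. F (v z, displacement v z))"

definition source_x :: "(real \<times> real \<Rightarrow> real) \<Rightarrow> (real \<times> real \<Rightarrow> real) \<Rightarrow> real \<times> real \<Rightarrow> real" where
  "source_x v w = (\<lambda>z. Fv (v z, displacement v z) * w z
    + Fu (v z, displacement v z) * displacement_x w z)"

abbreviation velocity :: "(real \<times> real \<Rightarrow> real) \<Rightarrow> real \<times> real \<Rightarrow> real" where
  "velocity v \<equiv> dalembert \<phi> \<psi> (source v)"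

abbreviation velocity_x ::
  "(real \<times> real \<Rightarrow> real) \<Rightarrow> (real \<times> real \<Rightarrow> real) \<Rightarrow> real \<times> real \<Rightarrow> real" where
  "velocity_x v w \<equiv> dalembert \<phi>' \<psi>' (source_x v w)"

lemma F_continuous: "continuous_on UNIV F"
  using F by (meson continuous_at_imp_continuous_on has_derivative_continuous)

lemma initial_data_continuous: "continuous_on UNIV h" "continuous_on UNIV \<phi>" "continuous_on UNIV \<psi>"
  using data_derivatives by (auto intro!: DERIV_isCont continuous_at_imp_continuous_on)

lemma displacement_continuous:
  assumes "continuous_on (strip T) v"
  shows "continuous_on (strip T) (displacement v)"
  unfolding displacement_def
  by (intro continuous_intros transport_continuous assms
      continuous_on_compose2[OF initial_data_continuous(1)]) auto

lemma displacement_x_continuous: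
  assumes "continuous_on (strip T) w"
  shows "continuous_on (strip T) (displacement_x w)"
  unfolding displacement_x_def
  by (intro continuous_intros transport_continuous assms
      continuous_on_compose2[OF data_continuous(1)]) auto

lemma state_continuous:
  assumes "continuous_on (strip T) v" "continuous_on UNIV G"
  shows "continuous_on (strip T) (\<lambda>z. G (v z, displacement v z))"
  by (intro continuous_on_compose2[OF assms(2)] continuous_intros assms displacement_continuous) auto

lemma source_continuous:
  assumes "continuous_on (strip T) v"
  shows "continuous_on (strip T) (source v)"
  unfolding source_def using assms F_continuous by (rule state_continuous)

lemma source_x_continuous:
  assumes "continuous_on (strip T) v" "continuous_on (strip T) w"
  shows "continuous_on (strip T) (source_x v w)"
  unfolding source_x_def
  by (intro continuous_intros state_continuous displacement_x_continuous assms Fv_Fu_continuous)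

lemma C1_in_x_displacement:
  assumes v: "C1_in_x T v w"
  shows "C1_in_x T (displacement v) (displacement_x w)"
proof -
  have "((\<lambda>y. displacement v (y, t)) has_real_derivative displacement_x w (x, t)) (at x)"
    if "t \<in> {0..T}" for x t
    using data_derivatives(1)[of x] C1_in_x_transport[OF v, of 0] that
    unfolding displacement_def displacement_x_def fst_conv snd_conv C1_in_x_def
    by (intro DERIV_add) auto
  then show ?thesis
    using v by (auto simp: C1_in_x_def displacement_continuous displacement_x_continuous)
qed

lemma C1_in_x_source:
  assumes v: "C1_in_x T v w"
  shows "C1_in_x T (source v) (source_x v w)"
proof -
  have "((\<lambda>y. source v (y, t)) has_real_derivative source_x v w (x, t)) (at x)"
    if t: "t \<in> {0..T}" for x t
  proof -
    have "((\<lambda>y. v (y, t)) has_derivative (\<lambda>d. w (x, t) * d)) (at x)"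
      "((\<lambda>y. displacement v (y, t)) has_derivative (\<lambda>d. displacement_x w (x, t) * d)) (at x)"
      using v C1_in_x_displacement[OF v] t by (auto simp: C1_in_x_def has_field_derivative_def)
    from has_derivative_compose[OF has_derivative_Pair[OF this] F]
    show ?thesis
      unfolding has_field_derivative_def source_def source_x_def
      by (rule has_derivative_eq_rhs) (auto simp: algebra_simps)
  qed
  then show ?thesis
    using v by (auto simp: C1_in_x_def source_continuous source_x_continuous)
qed

lemma C1_in_x_velocity:
  assumes "C1_in_x T v w"
  shows "C1_in_x T (velocity v) (velocity_x v w)"
  by (rule C1_in_x_dalembert[OF C1_in_x_source[OF assms]
        data_derivatives(2,3) data_continuous(2,3)])

lemma displacement_time_derivative:
  assumes "continuous_on (strip T) v" "t \<in> {0..T}"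
  shows "((\<lambda>s. displacement v (x, s)) has_real_derivative v (x, t)) (at t within {0..T})"
proof -
  have "continuous_on {0..T} (\<lambda>s. v (x, s))"
    using transport_path_continuous[OF assms(1) order_refl, of x 0] by simp
  from integral_has_real_derivative[OF this assms(2)]
  have "((\<lambda>s. transport 0 v (x, s)) has_real_derivative v (x, t)) (at t within {0..T})"
    by (simp add: transport_def)
  from DERIV_add[OF DERIV_const this] show ?thesis
    by (simp add: displacement_def)
qed

text \<open>
  Half the difference of the Riemann invariants, \<open>ux\<close> below, has time derivative \<open>w = \<partial>\<^sub>x v\<close> and
  initial value \<open>h'\<close>. So does the \<open>x\<close>-derivative of the displacement. The two agree, and the
  second derivatives of \<open>u\<close> are first derivatives of the invariants.
\<close>
lemma fixed_point_is_classical: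
  assumes v: "C1_in_x T v w" and fp: "\<forall>z\<in>strip T. velocity v z = v z"
  shows "Ck_strip 2 T (displacement v)"
    and "\<forall>z\<in>strip T. dt T (displacement v) z = v z"
    and "\<forall>z\<in>strip T. dt T (dt T (displacement v)) z - dx (dx (displacement v)) z
      = F (v z, displacement v z)"
proof -
  define S where "S = source v"
  define S' where "S' = source_x v w"
  define ux where "ux = (\<lambda>z. (\<phi> (fst z + snd z) - \<psi> (fst z - snd z)
    + transport 1 S z - transport (- 1) S z) / 2)"
  define uxx where "uxx = (\<lambda>z. (\<phi>' (fst z + snd z) - \<psi>' (fst z - snd z)
    + transport 1 S' z - transport (- 1) S' z) / 2)"
  have S: "C1_in_x T S S'" unfolding S_def S'_def by (rule C1_in_x_source[OF v])
  \<comment> \<open>differentiating the fixed-point equation in \<open>x\<close>\<close>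
  have w: "velocity_x v w z = w z" if "z \<in> strip T" for z
  proof -
    obtain x t where z: "z = (x, t)" and t: "t \<in> {0..T}" using \<open>z \<in> strip T\<close> by (auto simp: strip_def)
    have "(\<lambda>y. velocity v (y, t)) = (\<lambda>y. v (y, t))" using fp t by (auto simp: strip_def)
    then show ?thesis
      using v C1_in_x_velocity[OF v] t unfolding z C1_in_x_def by (metis DERIV_unique)
  qed
  have ux_t: "((\<lambda>s. ux (x, s)) has_real_derivative w (x, t)) (at t within {0..T})"
    if t: "t \<in> {0..T}" for x t
  proof -
    have 1: "((\<lambda>s. x - s) has_real_derivative - 1) (at t)"
      "((\<lambda>s. x + s) has_real_derivative 1) (at t)"
      by (auto intro!: derivative_eq_intros)
    have "((\<lambda>s. \<psi> (x - s)) has_real_derivative \<psi>' (x - t) * - 1) (at t within {0..T})"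
      "((\<lambda>s. \<phi> (x + s)) has_real_derivative \<phi>' (x + t) * 1) (at t within {0..T})"
      using DERIV_chain2[OF data_derivatives(3)[of "x - t"] 1(1)]
        DERIV_chain2[OF data_derivatives(2)[of "x + t"] 1(2)]
      by (auto intro: has_field_derivative_at_within)
    then have "((\<lambda>s. ux (x, s)) has_real_derivative
        (\<phi>' (x + t) * 1 - \<psi>' (x - t) * - 1 + (S (x, t) + 1 * transport 1 S' (x, t))
          - (S (x, t) + - 1 * transport (- 1) S' (x, t))) / 2) (at t within {0..T})"
      unfolding ux_def fst_conv snd_conv
      by (intro DERIV_cdivide DERIV_add DERIV_diff transport_time_derivative[OF S t])
    then show ?thesis
      by (rule DERIV_cong) (use w[of "(x, t)"] t in \<open>simp add: dalembert_def S'_def strip_def\<close>)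
  qed
  have ux: "displacement_x w z = ux z" if "z \<in> strip T" for z
  proof -
    obtain x t where z: "z = (x, t)" and t: "t \<in> {0..T}" using \<open>z \<in> strip T\<close> by (auto simp: strip_def)
    have "((\<lambda>s. w (x, s)) has_integral ux (x, t) - ux (x, 0)) {0..t}"
      using t by (intro fundamental_theorem_of_calculus)
        (auto simp flip: has_real_derivative_iff_has_vector_derivative
          intro!: DERIV_subset[OF ux_t])
    moreover have "ux (x, 0) = h' x"
      using compatible[of x] by (simp add: ux_def transport_def)
    ultimately show ?thesis
      by (simp add: displacement_x_def z transport_def has_integral_iff)
  qed
  have C1_ux: "C1_in_x T ux uxx"
  proof -
    have "((\<lambda>y. ux (y, t)) has_real_derivative uxx (x, t)) (at x)"
      if t: "t \<in> {0..T}" for x t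
    proof -
      have "((\<lambda>y. \<phi> (y + t)) has_real_derivative \<phi>' (x + t)) (at x)"
        "((\<lambda>y. \<psi> (y - t)) has_real_derivative \<psi>' (x - t)) (at x)"
        using DERIV_shift[of \<phi> _ x t] DERIV_shift[of \<psi> _ x "- t"]
          data_derivatives(2)[of "x + t"] data_derivatives(3)[of "x - t"] by auto
      moreover have "((\<lambda>y. transport \<sigma> S (y, t)) has_real_derivative transport \<sigma> S' (x, t)) (at x)" for \<sigma>
        using C1_in_x_transport[OF S, of \<sigma>] t by (simp add: C1_in_x_def)
      ultimately show ?thesis
        unfolding ux_def uxx_def fst_conv snd_conv
        by (intro DERIV_cdivide DERIV_add DERIV_diff)
    qed
    moreover have "continuous_on (strip T) ux" "continuous_on (strip T) uxx"
      unfolding ux_def uxx_def using S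
      by (auto intro!: continuous_intros transport_continuous initial_data_continuous
        simp: C1_in_x_def data_continuous initial_data_continuous
        intro: continuous_on_compose2[OF initial_data_continuous(2)]
          continuous_on_compose2[OF initial_data_continuous(3)]
          continuous_on_compose2[OF data_continuous(2)] continuous_on_compose2[OF data_continuous(3)])
    ultimately show ?thesis by (simp add: C1_in_x_def)
  qed
  have C1_u: "C1_in_x T (displacement v) ux"
    using C1_in_x_displacement[OF v] C1_ux ux
    by (auto simp: C1_in_x_def strip_def)
  have vt: "((\<lambda>s. v (x, s)) has_real_derivative S (x, t) + uxx (x, t)) (at t within {0..T})"
    if t: "t \<in> {0..T}" for x t
  proof (rule has_field_derivative_transform_within[OF _ zero_less_one t])
    show "((\<lambda>s. velocity v (x, s)) has_real_derivative S (x, t) + uxx (x, t)) (at t within {0..T})"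
      unfolding uxx_def S_def S'_def fst_conv snd_conv
      by (rule dalembert_time_derivative[OF C1_in_x_source[OF v] t data_derivatives(2,3)])
  qed (use fp in \<open>auto simp: strip_def\<close>)
  have "continuous_on (strip T) w" "continuous_on (strip T) (\<lambda>z. S z + uxx z)"
    using v S C1_ux by (auto simp: C1_in_x_def intro!: continuous_intros)
  note C2 = C2_strip_criterion[OF T C1_u C1_ux v displacement_time_derivative ux_t vt this]
  show "Ck_strip 2 T (displacement v)" "\<forall>z\<in>strip T. dt T (displacement v) z = v z"
    using C2(1,2) v by (auto simp: C1_in_x_def)
  show "\<forall>z\<in>strip T. dt T (dt T (displacement v)) z - dx (dx (displacement v)) z
      = F (v z, displacement v z)"
    using C2(3,4) v by (auto simp: C1_in_x_def S_def source_def)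
qed

section \<open>Exponentially weighted estimates\<close>

text \<open>A compact convex set that contains all pairs \<open>(v, u)\<close> occurring while \<open>\<bar>v\<bar> \<le> M\<close>.\<close>
definition state_box :: "real \<Rightarrow> (real \<times> real) set" where
  "state_box M = {- M..M} \<times> {- (D + T * M)..D + T * M}"

lemma compact_state_box: "compact (state_box M)" and convex_state_box: "convex (state_box M)"
  by (auto simp: state_box_def intro: compact_Times convex_Times)

lemma D_nonneg: "0 \<le> D"
  using data_bounds(1)[of 0] by simp

lemma transport_0_bound:
  assumes v: "continuous_on (strip T) v" and z: "z \<in> strip T"
    and le: "\<And>z. z \<in> strip T \<Longrightarrow> \<bar>v z\<bar> \<le> M"
  shows "\<bar>transport 0 v z\<bar> \<le> T * M"
proof -
  obtain x t where z_eq: "z = (x, t)" and t: "0 \<le> t" "t \<le> T"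
    using z by (auto simp: strip_def)
  have "norm (integral {0..t} (\<lambda>s. v (x + 0 * (t - s), s))) \<le> M * (t - 0)"
    using t le by (intro integral_bound transport_path_continuous[OF v]) (auto simp: strip_def)
  also have "M * (t - 0) \<le> T * M"
    using t le[OF z] by (subst mult.commute, intro mult_mono) auto
  finally show ?thesis by (simp add: z_eq transport_def)
qed

lemma state_in_box:
  assumes "continuous_on (strip T) v" "z \<in> strip T" "\<And>z. z \<in> strip T \<Longrightarrow> \<bar>v z\<bar> \<le> M"
  shows "(v z, displacement v z) \<in> state_box M"
  using transport_0_bound[OF assms] assms(3)[OF assms(2)] data_bounds(1)[of "fst z"]
  unfolding state_box_def displacement_def by (auto simp: abs_le_iff)

lemma F_lipschitz:
  assumes L: "\<forall>p\<in>state_box M. \<bar>Fv p\<bar> \<le> L \<and> \<bar>Fu p\<bar> \<le> L" and L0: "0 \<le> L"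
    and p: "p \<in> state_box M" and q: "q \<in> state_box M"
  shows "\<bar>F p - F q\<bar> \<le> 2 * L * (\<bar>fst p - fst q\<bar> + \<bar>snd p - snd q\<bar>)"
proof -
  have "onorm (\<lambda>d. Fv z * fst d + Fu z * snd d) \<le> 2 * L" if "z \<in> state_box M" for z
  proof (rule onorm_le)
    fix d :: "real \<times> real"
    have "\<bar>Fv z * fst d + Fu z * snd d\<bar> \<le> \<bar>Fv z\<bar> * \<bar>fst d\<bar> + \<bar>Fu z\<bar> * \<bar>snd d\<bar>"
      using abs_triangle_ineq[of "Fv z * fst d" "Fu z * snd d"] by (simp add: abs_mult)
    also have "\<dots> \<le> L * norm d + L * norm d"
      using L L0 that norm_fst_le[of "fst d" "snd d"] norm_snd_le[of "snd d" "fst d"]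
      by (intro add_mono mult_mono) auto
    finally show "norm (Fv z * fst d + Fu z * snd d) \<le> 2 * L * norm d" by simp
  qed
  then have "norm (F p - F q) \<le> 2 * L * norm (p - q)"
    using p q by (intro differentiable_bound[OF convex_state_box has_derivative_at_withinI[OF F]])
  also have "\<dots> \<le> 2 * L * (\<bar>fst p - fst q\<bar> + \<bar>snd p - snd q\<bar>)"
    using L0 norm_Pair_le[of "fst p - fst q" "snd p - snd q"]
    by (intro mult_left_mono) (auto simp: minus_prod_def)
  finally show ?thesis by simp
qed

lemma displacement_exp_diff:
  assumes "continuous_on (strip T) v" "continuous_on (strip T) v'" and "\<mu> \<ge> 1" and z: "z \<in> strip T"
    and le: "\<And>z. z \<in> strip T \<Longrightarrow> \<bar>v z - v' z\<bar> \<le> k * exp (\<mu> * snd z)"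
  shows "\<bar>transport 0 v z - transport 0 v' z\<bar> \<le> k * exp (\<mu> * snd z)"
proof -
  have "transport 0 v z - transport 0 v' z = transport 0 (\<lambda>z. v z - v' z) z"
    using transport_diff[OF assms(1,2), of "snd z" 0 "fst z"] z by (auto simp: strip_def)
  also have "\<bar>\<dots>\<bar> \<le> k / \<mu> * exp (\<mu> * snd z)"
    using assms by (intro transport_exp_bound[where T = T]) (auto intro: continuous_on_diff)
  also have "\<dots> \<le> k * exp (\<mu> * snd z)"
  proof -
    have "0 \<le> k * exp (\<mu> * snd z)" using le[OF z] by linarith
    then have "0 \<le> k" by (simp add: zero_le_mult_iff)
    then have "k / \<mu> \<le> k" using \<open>\<mu> \<ge> 1\<close> by (simp add: divide_le_eq mult_le_cancel_left1)
    then show ?thesis by (intro mult_right_mono) auto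
  qed
  finally show ?thesis .
qed

text \<open>
  The source is Lipschitz in velocity and displacement with constant \<open>2 L\<close>, and the
  displacement is no farther apart than the velocity; integration gains \<open>1 / \<mu>\<close>, and \<open>4 L / \<mu> \<le> 1 / 2\<close>.
\<close>
lemma velocity_contracts:
  assumes L: "\<forall>p\<in>state_box M. \<bar>Fv p\<bar> \<le> L \<and> \<bar>Fu p\<bar> \<le> L" and L0: "0 \<le> L" and \<mu>: "\<mu> = 8 * L + 1"
    and v: "continuous_on (strip T) v" "\<And>z. z \<in> strip T \<Longrightarrow> \<bar>v z\<bar> \<le> M"
    and v': "continuous_on (strip T) v'" "\<And>z. z \<in> strip T \<Longrightarrow> \<bar>v' z\<bar> \<le> M"
    and le: "\<And>z. z \<in> strip T \<Longrightarrow> \<bar>v z - v' z\<bar> \<le> k * exp (\<mu> * snd z)" and z: "z \<in> strip T"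
  shows "\<bar>velocity v z - velocity v' z\<bar> \<le> k / 2 * exp (\<mu> * snd z)"
proof -
  have \<mu>1: "\<mu> \<ge> 1" using L0 \<mu> by simp
  have "0 \<le> k * exp (\<mu> * snd z)" using le[OF z] by linarith
  then have k: "0 \<le> k" by (simp add: zero_le_mult_iff)
  have "\<bar>source v z - source v' z\<bar> \<le> 4 * L * k * exp (\<mu> * snd z)" if z: "z \<in> strip T" for z
  proof -
    have "\<bar>source v z - source v' z\<bar> \<le> 2 * L * (\<bar>v z - v' z\<bar> + \<bar>displacement v z - displacement v' z\<bar>)"
      using F_lipschitz[OF L L0 state_in_box[OF v(1) z v(2)] state_in_box[OF v'(1) z v'(2)]]
      by (simp add: source_def)
    also have "\<dots> \<le> 2 * L * (k * exp (\<mu> * snd z) + k * exp (\<mu> * snd z))"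
      using L0 le[OF z] displacement_exp_diff[OF v(1) v'(1) \<mu>1 z le]
      by (intro mult_left_mono add_mono) (auto simp: displacement_def)
    finally show ?thesis by (simp add: algebra_simps)
  qed
  then have "\<bar>velocity v z - velocity v' z\<bar> \<le> 4 * L * k / \<mu> * exp (\<mu> * snd z)"
    using \<mu>1 z by (intro dalembert_exp_diff[where T = T] source_continuous v v') auto
  also have "\<dots> \<le> k / 2 * exp (\<mu> * snd z)"
    using k L0 \<mu> \<mu>1 by (intro mult_right_mono) (auto simp: field_simps)
  finally show ?thesis .
qed

lemma displacement_x_exp_bound:
  assumes w: "continuous_on (strip T) w" and "\<mu> \<ge> 1" and z: "z \<in> strip T"
    and le: "\<And>z. z \<in> strip T \<Longrightarrow> \<bar>w z\<bar> \<le> C * exp (\<mu> * snd z)"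
  shows "\<bar>displacement_x w z\<bar> \<le> (D + C) * exp (\<mu> * snd z)"
proof -
  have E: "1 \<le> exp (\<mu> * snd z)" using z \<open>\<mu> \<ge> 1\<close> by (auto simp: strip_def)
  have "\<bar>transport 0 w z\<bar> \<le> C * exp (\<mu> * snd z)"
    using displacement_exp_diff[OF w _ \<open>\<mu> \<ge> 1\<close> z, of "\<lambda>_. 0" C] le
    by (auto simp: transport_def split_beta)
  moreover have "D \<le> D * exp (\<mu> * snd z)"
    using E D_nonneg mult_left_mono[OF E D_nonneg] by simp
  ultimately show ?thesis
    using data_bounds(2)[of "fst z"] unfolding displacement_x_def distrib_right by linarith
qed

text \<open>
  The bound \<open>2 D exp (\<mu> t)\<close> reproduces itself: the data contribute \<open>D\<close>, and the source, at most
  \<open>5 L D exp (\<mu> t)\<close>, contributes no more than \<open>D exp (\<mu> t)\<close> as \<open>5 L \<le> \<mu>\<close>.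
\<close>
lemma velocity_x_exp_bound:
  assumes L: "\<forall>p\<in>state_box M. \<bar>Fv p\<bar> \<le> L \<and> \<bar>Fu p\<bar> \<le> L" and L0: "0 \<le> L" and \<mu>: "\<mu> = 8 * L + 1"
    and v: "continuous_on (strip T) v" "\<And>z. z \<in> strip T \<Longrightarrow> \<bar>v z\<bar> \<le> M"
    and w: "continuous_on (strip T) w" "\<And>z. z \<in> strip T \<Longrightarrow> \<bar>w z\<bar> \<le> 2 * D * exp (\<mu> * snd z)"
    and z: "z \<in> strip T"
  shows "\<bar>velocity_x v w z\<bar> \<le> 2 * D * exp (\<mu> * snd z)"
proof -
  have \<mu>1: "\<mu> \<ge> 1" using L0 \<mu> by simp
  have "\<bar>source_x v w z\<bar> \<le> L * (5 * D) * exp (\<mu> * snd z)" if z: "z \<in> strip T" for z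
  proof -
    let ?p = "(v z, displacement v z)"
    have p: "\<bar>Fv ?p\<bar> \<le> L" "\<bar>Fu ?p\<bar> \<le> L" using L state_in_box[OF v(1) z v(2)] by auto
    have "\<bar>source_x v w z\<bar> \<le> \<bar>Fv ?p\<bar> * \<bar>w z\<bar> + \<bar>Fu ?p\<bar> * \<bar>displacement_x w z\<bar>"
      unfolding source_x_def by (metis abs_mult abs_triangle_ineq)
    also have "\<dots> \<le> L * (2 * D * exp (\<mu> * snd z)) + L * ((D + 2 * D) * exp (\<mu> * snd z))"
      using p w(2)[OF z] displacement_x_exp_bound[OF w(1) \<mu>1 z w(2)] L0
      by (intro add_mono mult_mono) auto
    finally show ?thesis by (simp add: algebra_simps)
  qed
  then have "\<bar>velocity_x v w z\<bar> \<le> D + L * (5 * D) / \<mu> * exp (\<mu> * snd z)"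
    using \<mu>1 z data_bounds by (intro dalembert_exp_bound[where T = T] source_x_continuous v w) auto
  also have "\<dots> \<le> D * exp (\<mu> * snd z) + D * exp (\<mu> * snd z)"
  proof (intro add_mono mult_right_mono)
    have "1 \<le> exp (\<mu> * snd z)" using z \<mu>1 by (auto simp: strip_def)
    from mult_left_mono[OF this D_nonneg] show "D \<le> D * exp (\<mu> * snd z)" by simp
    have "L * (5 * D) \<le> D * \<mu>"
      using D_nonneg L0 mult_nonneg_nonneg[OF D_nonneg L0] by (simp add: \<mu> algebra_simps)
    then show "L * (5 * D) / \<mu> \<le> D" using \<mu>1 by (simp add: divide_le_eq)
  qed simp
  finally show ?thesis by simp
qed

text \<open>
  The map is affine in \<open>w\<close>, with coefficients bounded by \<open>L\<close>, which gives the factor \<open>1 / 2\<close>;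
  replacing the coefficients at \<open>v\<close> by those at \<open>v'\<close> costs only \<open>\<eta>\<close> times the bound of \<open>w'\<close>.
\<close>
lemma velocity_x_asymptotically_contracts:
  assumes L: "\<forall>p\<in>state_box M. \<bar>Fv p\<bar> \<le> L \<and> \<bar>Fu p\<bar> \<le> L" and L0: "0 \<le> L" and \<mu>: "\<mu> = 8 * L + 1"
    and v: "continuous_on (strip T) v" "\<And>z. z \<in> strip T \<Longrightarrow> \<bar>v z\<bar> \<le> M"
    and v': "continuous_on (strip T) v'"
    and w: "continuous_on (strip T) w"
    and w': "continuous_on (strip T) w'" "\<And>z. z \<in> strip T \<Longrightarrow> \<bar>w' z\<bar> \<le> 2 * D * exp (\<mu> * snd z)"
    and coeff: "\<And>z. z \<in> strip T \<Longrightarrow> \<bar>Fv (v z, displacement v z) - Fv (v' z, displacement v' z)\<bar> \<le> \<eta>"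
      "\<And>z. z \<in> strip T \<Longrightarrow> \<bar>Fu (v z, displacement v z) - Fu (v' z, displacement v' z)\<bar> \<le> \<eta>"
    and le: "\<And>z. z \<in> strip T \<Longrightarrow> \<bar>w z - w' z\<bar> \<le> k * exp (\<mu> * snd z)" and z: "z \<in> strip T"
  shows "\<bar>velocity_x v w z - velocity_x v' w' z\<bar> \<le> (k / 2 + 5 * D * \<eta>) * exp (\<mu> * snd z)"
proof -
  have \<mu>1: "\<mu> \<ge> 1" using L0 \<mu> by simp
  have "0 \<le> k * exp (\<mu> * snd z)" using le[OF z] by linarith
  then have k: "0 \<le> k" by (simp add: zero_le_mult_iff)
  have \<eta>: "0 \<le> \<eta>" using coeff(1)[OF z] by linarith
  have prod: "\<bar>c * x - c' * x'\<bar> \<le> L * (k * e) + \<eta> * y"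
    if "\<bar>c\<bar> \<le> L" "\<bar>x - x'\<bar> \<le> k * e" "\<bar>c - c'\<bar> \<le> \<eta>" "\<bar>x'\<bar> \<le> y" for c x c' x' y e :: real
  proof -
    have "\<bar>c * x - c' * x'\<bar> = \<bar>c * (x - x') + (c - c') * x'\<bar>" by (simp add: algebra_simps)
    also have "\<dots> \<le> \<bar>c\<bar> * \<bar>x - x'\<bar> + \<bar>c - c'\<bar> * \<bar>x'\<bar>" by (metis abs_mult abs_triangle_ineq)
    also have "\<dots> \<le> L * (k * e) + \<eta> * y" using that L0 \<eta> by (intro add_mono mult_mono) auto
    finally show ?thesis .
  qed
  have "\<bar>source_x v w z - source_x v' w' z\<bar> \<le> (2 * L * k + 5 * D * \<eta>) * exp (\<mu> * snd z)"
    if z: "z \<in> strip T" for z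
  proof -
    let ?p = "(v z, displacement v z)" and ?p' = "(v' z, displacement v' z)"
    have p: "\<bar>Fv ?p\<bar> \<le> L" "\<bar>Fu ?p\<bar> \<le> L" using L state_in_box[OF v(1) z v(2)] by auto
    have "\<bar>displacement_x w z - displacement_x w' z\<bar> \<le> k * exp (\<mu> * snd z)"
      using displacement_exp_diff[OF w w'(1) \<mu>1 z le] by (simp add: displacement_x_def)
    note 1 = prod[OF p(2) this coeff(2)[OF z] displacement_x_exp_bound[OF w'(1) \<mu>1 z w'(2)]]
    note 2 = prod[OF p(1) le[OF z] coeff(1)[OF z] w'(2)[OF z]]
    have "(2 * L * k + 5 * D * \<eta>) * exp (\<mu> * snd z) =
        (L * (k * exp (\<mu> * snd z)) + \<eta> * (2 * D * exp (\<mu> * snd z))) +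
        (L * (k * exp (\<mu> * snd z)) + \<eta> * ((D + 2 * D) * exp (\<mu> * snd z)))"
      by (simp add: algebra_simps)
    with 1 2 show ?thesis unfolding source_x_def by linarith
  qed
  then have "\<bar>velocity_x v w z - velocity_x v' w' z\<bar>
      \<le> (2 * L * k + 5 * D * \<eta>) / \<mu> * exp (\<mu> * snd z)"
    using \<mu>1 z by (intro dalembert_exp_diff[where T = T] source_x_continuous v v' w w') auto
  also have "\<dots> \<le> (k / 2 + 5 * D * \<eta>) * exp (\<mu> * snd z)"
  proof (intro mult_right_mono)
    have "0 \<le> D * \<eta>" "0 \<le> L * k" "0 \<le> L * (D * \<eta>)"
      using D_nonneg \<eta> L0 k by simp_all
    then have "2 * L * k + 5 * D * \<eta> \<le> (k / 2 + 5 * D * \<eta>) * \<mu>"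
      using k by (simp add: \<mu> algebra_simps)
    then show "(2 * L * k + 5 * D * \<eta>) / \<mu> \<le> k / 2 + 5 * D * \<eta>"
      using \<mu>1 by (simp add: divide_le_eq)
  qed simp
  finally show ?thesis .
qed

end

section \<open>Convergence of the iteration\<close>

text \<open>
  Beyond \<open>n\<^sub>0\<close>, each step halves the distance of two tails up to \<open>\<eta>\<close>, so \<open>j\<close> further steps
  leave at most \<open>2 C / 2\<^sup>j + 2 \<eta>\<close>. Unlike in Banach's theorem the map may change with the index,
  which is what the sequence of spatial derivatives requires.
\<close>
lemma uniformly_convergent_on_asymptotic_contraction:
  fixes y :: "nat \<Rightarrow> 'a \<Rightarrow> real"
  assumes bound: "\<And>n z. z \<in> Z \<Longrightarrow> \<bar>y n z\<bar> \<le> C * E z"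
    and E: "\<And>z. z \<in> Z \<Longrightarrow> 0 \<le> E z" "\<And>z. z \<in> Z \<Longrightarrow> E z \<le> E\<^sub>0"
    and contr: "\<And>\<eta>. \<eta> > 0 \<Longrightarrow> \<exists>n\<^sub>0. \<forall>n\<ge>n\<^sub>0. \<forall>m\<ge>n\<^sub>0. \<forall>k\<ge>0.
      (\<forall>z\<in>Z. \<bar>y n z - y m z\<bar> \<le> k * E z) \<longrightarrow>
      (\<forall>z\<in>Z. \<bar>y (Suc n) z - y (Suc m) z\<bar> \<le> (k / 2 + \<eta>) * E z)"
  shows "uniformly_convergent_on Z y"
proof (rule Cauchy_uniformly_convergent, rule uniformly_Cauchy_onI')
  fix e :: real assume e: "e > 0"
  define C' where "C' = \<bar>C\<bar>"
  \<comment> \<open>half of \<open>e\<close> is for the accumulated errors \<open>2 \<eta>\<close>, the other half for the geometric term\<close>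
  define \<eta> where "\<eta> = e / (4 * (\<bar>E\<^sub>0\<bar> + 1))"
  have \<eta>: "\<eta> > 0" using e by (auto simp: \<eta>_def)
  from contr[OF \<eta>] obtain n0 where n0: "\<And>n m k z. n \<ge> n0 \<Longrightarrow> m \<ge> n0 \<Longrightarrow> k \<ge> 0 \<Longrightarrow>
      (\<And>z. z \<in> Z \<Longrightarrow> \<bar>y n z - y m z\<bar> \<le> k * E z) \<Longrightarrow> z \<in> Z \<Longrightarrow>
      \<bar>y (Suc n) z - y (Suc m) z\<bar> \<le> (k / 2 + \<eta>) * E z"
    by blast
  have ind: "\<bar>y n z - y m z\<bar> \<le> (2 * C' / 2 ^ j + 2 * \<eta>) * E z"
    if "n \<ge> n0 + j" "m \<ge> n0 + j" "z \<in> Z" for j n m z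
    using that
  proof (induction j arbitrary: n m z)
    case 0
    have "\<bar>y n z - y m z\<bar> \<le> C * E z + C * E z" using bound[OF 0(3), of n] bound[OF 0(3), of m] by linarith
    moreover have "C * E z \<le> C' * E z" "0 \<le> \<eta> * E z"
      using E(1)[OF 0(3)] \<eta> by (auto simp: C'_def intro!: mult_right_mono)
    ultimately have "\<bar>y n z - y m z\<bar> \<le> (2 * C' + 2 * \<eta>) * E z"
      by (simp add: distrib_right)
    then show ?case by simp
  next
    case (Suc j)
    from Suc.prems obtain n' m' where nm: "n = Suc n'" "m = Suc m'" "n' \<ge> n0 + j" "m' \<ge> n0 + j"
      by (metis Suc_le_D Suc_le_mono add_Suc_right)
    have "\<bar>y (Suc n') z - y (Suc m') z\<bar> \<le> ((2 * C' / 2 ^ j + 2 * \<eta>) / 2 + \<eta>) * E z"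
      using nm Suc.prems Suc.IH \<eta> by (intro n0) (auto simp: C'_def)
    then show ?case by (simp add: nm add_divide_distrib add.commute)
  qed
  have "(\<lambda>j. (2 * C' / 2 ^ j) * \<bar>E\<^sub>0\<bar>) \<longlonglongrightarrow> (2 * C' * 0) * \<bar>E\<^sub>0\<bar>"
    unfolding divide_inverse by (intro tendsto_intros LIMSEQ_inverse_realpow_zero) simp
  then have "eventually (\<lambda>j. (2 * C' / 2 ^ j) * \<bar>E\<^sub>0\<bar> < e / 2) sequentially"
    using e by (auto dest!: order_tendstoD(2)[where a = "e / 2"])
  then obtain j where j: "(2 * C' / 2 ^ j) * \<bar>E\<^sub>0\<bar> < e / 2"
    by (auto simp: eventually_sequentially)
  have eta: "2 * \<eta> * \<bar>E\<^sub>0\<bar> \<le> e / 2"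
    using e by (simp add: \<eta>_def field_simps)
  show "\<exists>M. \<forall>x\<in>Z. \<forall>m\<ge>M. \<forall>n>m. dist (y m x) (y n x) < e"
  proof (intro exI[of _ "n0 + j"] ballI allI impI)
    fix z m n assume z: "z \<in> Z" and "m \<ge> n0 + j" "n > m"
    then have "\<bar>y m z - y n z\<bar> \<le> (2 * C' / 2 ^ j + 2 * \<eta>) * E z"
      by (intro ind) auto
    also have "\<dots> \<le> (2 * C' / 2 ^ j + 2 * \<eta>) * \<bar>E\<^sub>0\<bar>"
      using E[OF z] \<eta> by (intro mult_left_mono) (auto simp: C'_def)
    also have "\<dots> < e" using j eta by (simp add: distrib_right)
    finally show "dist (y m z) (y n z) < e" by (simp add: dist_real_def)
  qed
qed

context semilinear_wave
begin

lemma coefficient_bound: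
  "\<exists>L\<ge>0. \<forall>p\<in>state_box M. \<bar>Fv p\<bar> \<le> L \<and> \<bar>Fu p\<bar> \<le> L"
proof -
  have "bounded (Fv ` state_box M)" "bounded (Fu ` state_box M)"
    by (intro compact_imp_bounded compact_continuous_image compact_state_box
        continuous_on_subset[OF Fv_Fu_continuous(1)] continuous_on_subset[OF Fv_Fu_continuous(2)]; simp)+
  then obtain a b where "\<forall>p\<in>state_box M. \<bar>Fv p\<bar> \<le> a" "\<forall>p\<in>state_box M. \<bar>Fu p\<bar> \<le> b"
    by (auto simp: bounded_iff)
  then show ?thesis
    by (intro exI[of _ "max 0 (max a b)"]) (auto simp: le_max_iff_disj)
qed

text \<open>Uniform continuity of \<open>G\<close> on the compact set of states replaces a Lipschitz bound.\<close>
lemma coefficients_uniformly_Cauchy: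
  assumes v: "\<And>n. continuous_on (strip T) (v n)" "\<And>n z. z \<in> strip T \<Longrightarrow> \<bar>v n z\<bar> \<le> M"
    and conv: "uniformly_convergent_on (strip T) v"
    and G: "continuous_on UNIV G" and \<eta>: "0 < (\<eta>::real)"
  shows "\<exists>n\<^sub>0. \<forall>n\<ge>n\<^sub>0. \<forall>m\<ge>n\<^sub>0. \<forall>z\<in>strip T.
    \<bar>G (v n z, displacement (v n) z) - G (v m z, displacement (v m) z)\<bar> \<le> \<eta>"
proof -
  have "uniformly_continuous_on (state_box M) G"
    by (intro compact_uniformly_continuous continuous_on_subset[OF G] compact_state_box) simp
  then obtain \<delta> where \<delta>: "\<delta> > 0" and uc: "\<And>p q. p \<in> state_box M \<Longrightarrow> q \<in> state_box M \<Longrightarrow>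
      dist q p < \<delta> \<Longrightarrow> dist (G q) (G p) < \<eta>"
    using \<eta> unfolding uniformly_continuous_on_def by metis
  define \<delta>' where "\<delta>' = \<delta> / 2 / (1 + T)"
  have "\<delta>' > 0" using \<delta> T by (simp add: \<delta>'_def)
  have "\<delta>' + T * \<delta>' = (1 + T) * \<delta>'" by (simp add: distrib_right)
  also have "\<dots> = \<delta> / 2" using nonzero_mult_div_cancel_left[of "1 + T" "\<delta> / 2"] T unfolding \<delta>'_def by auto
  also have "\<dots> < \<delta>" using \<delta> by simp
  finally have \<delta>': "\<delta>' > 0" "\<delta>' + T * \<delta>' < \<delta>" using \<open>\<delta>' > 0\<close> by blast+
  from conv have "uniformly_Cauchy_on (strip T) v"
    by (simp add: uniformly_convergent_eq_Cauchy)
  then obtain n0 where n0: "\<And>n m z. n \<ge> n0 \<Longrightarrow> m \<ge> n0 \<Longrightarrow> z \<in> strip T \<Longrightarrow> dist (v m z) (v n z) < \<delta>'"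
    using \<delta>'(1) unfolding uniformly_Cauchy_on_def by metis
  have "\<bar>G (v n z, displacement (v n) z) - G (v m z, displacement (v m) z)\<bar> \<le> \<eta>"
    if n: "n \<ge> n0" and m: "m \<ge> n0" and z: "z \<in> strip T" for n m z
  proof -
    have close: "\<bar>v n z - v m z\<bar> \<le> \<delta>'" if "z \<in> strip T" for z
      using n0[OF m n that] by (simp add: dist_real_def)
    have "displacement (v n) z - displacement (v m) z = transport 0 (\<lambda>z. v n z - v m z) z"
      using transport_diff[OF v(1)[of n] v(1)[of m], of "snd z" 0 "fst z"] z
      by (auto simp: strip_def displacement_def)
    then have "\<bar>displacement (v n) z - displacement (v m) z\<bar> \<le> T * \<delta>'"
      using transport_0_bound[OF continuous_on_diff[OF v(1) v(1)] z close] by simp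
    then have "dist (v n z, displacement (v n) z) (v m z, displacement (v m) z) < \<delta>"
      using close[OF z] \<delta>'(2)
        norm_Pair_le[of "v n z - v m z" "displacement (v n) z - displacement (v m) z"]
      by (simp add: dist_norm)
    then have "dist (G (v n z, displacement (v n) z)) (G (v m z, displacement (v m) z)) < \<eta>"
      by (intro uc state_in_box v z)
    then show ?thesis by (simp add: dist_real_def)
  qed
  then show ?thesis by blast
qed

text \<open>
  The iteration starts at \<open>0\<close> and stays below \<open>W\<close>, hence in a bounded set of velocities, where it
  contracts for a suitable \<open>\<mu>\<close>. Iterating the pair \<open>(v, w)\<close> keeps \<open>w\<^sub>n = \<partial>\<^sub>x v\<^sub>n\<close>, and the uniform limits
  inherit this relation.
\<close>
theorem velocity_fixed_point:
  assumes W: "\<And>z. z \<in> strip T \<Longrightarrow> 0 \<le> W z" "\<And>z. z \<in> strip T \<Longrightarrow> W z \<le> M"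
    and inv: "\<And>v. continuous_on (strip T) v \<Longrightarrow> \<forall>z\<in>strip T. \<bar>v z\<bar> \<le> W z \<Longrightarrow>
      \<forall>z\<in>strip T. \<bar>velocity v z\<bar> \<le> W z"
  shows "\<exists>v w. C1_in_x T v w \<and> (\<forall>z\<in>strip T. velocity v z = v z)"
proof -
  obtain L where L0: "0 \<le> L" and L: "\<forall>p\<in>state_box M. \<bar>Fv p\<bar> \<le> L \<and> \<bar>Fu p\<bar> \<le> L"
    using coefficient_bound[of M] by blast
  define \<mu> where "\<mu> = 8 * L + 1"
  define E where "E = (\<lambda>z::real \<times> real. exp (\<mu> * snd z))"
  have \<mu>0: "\<mu> \<ge> 0" using L0 by (simp add: \<mu>_def)
  have E: "0 \<le> E z" "1 \<le> E z" "E z \<le> exp (\<mu> * T)" if "z \<in> strip T" for z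
    using that \<mu>0 by (auto simp: E_def strip_def mult_left_mono)
  \<comment> \<open>\<open>w n\<close> is defined by the differentiated iteration and only then shown to be \<open>\<partial>\<^sub>x\<close> of \<open>v n\<close>\<close>
  define vw where "vw n = ((\<lambda>(v, w). (velocity v, velocity_x v w)) ^^ n) (\<lambda>_. 0, \<lambda>_. 0)" for n
  define v where "v n = fst (vw n)" for n
  define w where "w n = snd (vw n)" for n
  have v_0: "v 0 = (\<lambda>_. 0)" and w_0: "w 0 = (\<lambda>_. 0)"
    and v_Suc: "v (Suc n) = velocity (v n)" and w_Suc: "w (Suc n) = velocity_x (v n) (w n)" for n
    by (simp_all add: v_def w_def vw_def split_beta)
  have C1: "C1_in_x T (v n) (w n)" for n
  proof (induction n)
    case 0
    show ?case by (simp add: v_0 w_0 C1_in_x_def)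
  next
    case (Suc n)
    then show ?case unfolding v_Suc w_Suc by (rule C1_in_x_velocity)
  qed
  have v_cont: "continuous_on (strip T) (v n)" and w_cont: "continuous_on (strip T) (w n)"
    and v_x: "t \<in> {0..T} \<Longrightarrow> ((\<lambda>y. v n (y, t)) has_real_derivative w n (x, t)) (at x)" for n x t
    using C1[of n] by (auto simp: C1_in_x_def)
  have vW: "\<forall>z\<in>strip T. \<bar>v n z\<bar> \<le> W z" for n
  proof (induction n)
    case 0
    show ?case using W(1) by (simp add: v_0)
  next
    case (Suc n)
    show ?case unfolding v_Suc by (rule inv[OF v_cont Suc.IH])
  qed
  have vM: "\<bar>v n z\<bar> \<le> M" if "z \<in> strip T" for n z
    using vW[of n] W(2)[OF that] that by fastforce
  have wE: "\<forall>z\<in>strip T. \<bar>w n z\<bar> \<le> 2 * D * exp (\<mu> * snd z)" for n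
  proof (induction n)
    case 0
    show ?case using D_nonneg by (simp add: w_0)
  next
    case (Suc n)
    then show ?case unfolding w_Suc
      by (intro ballI velocity_x_exp_bound[OF L L0 \<mu>_def v_cont vM w_cont]) auto
  qed
  have "uniformly_convergent_on (strip T) v"
  proof (rule uniformly_convergent_on_asymptotic_contraction[where E = E])
    show "\<bar>v n z\<bar> \<le> M * E z" if "z \<in> strip T" for n z
    proof -
      have "M * 1 \<le> M * E z" using E(2)[OF that] vM[OF that, of 0] by (intro mult_left_mono) auto
      with vM[OF that, of n] show ?thesis by simp
    qed
    show "\<exists>n\<^sub>0. \<forall>n\<ge>n\<^sub>0. \<forall>m\<ge>n\<^sub>0. \<forall>k\<ge>0. (\<forall>z\<in>strip T. \<bar>v n z - v m z\<bar> \<le> k * E z) \<longrightarrow>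
        (\<forall>z\<in>strip T. \<bar>v (Suc n) z - v (Suc m) z\<bar> \<le> (k / 2 + \<eta>) * E z)" if "0 < \<eta>" for \<eta>
    proof (intro exI[of _ 0] allI impI ballI)
      fix n m k z assume le: "\<forall>z\<in>strip T. \<bar>v n z - v m z\<bar> \<le> k * E z" and z: "z \<in> strip T"
      have "\<bar>v (Suc n) z - v (Suc m) z\<bar> \<le> k / 2 * E z"
        using le unfolding v_Suc E_def
        by (intro velocity_contracts[OF L L0 \<mu>_def v_cont vM v_cont vM _ z]) auto
      also have "\<dots> \<le> (k / 2 + \<eta>) * E z"
        using E(1)[OF z] \<open>0 < \<eta>\<close> by (intro mult_right_mono) auto
      finally show "\<bar>v (Suc n) z - v (Suc m) z\<bar> \<le> (k / 2 + \<eta>) * E z" .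
    qed
  qed (use E in auto)
  moreover have "uniformly_convergent_on (strip T) w"
  proof (rule uniformly_convergent_on_asymptotic_contraction[where E = E])
    show "\<bar>w n z\<bar> \<le> 2 * D * E z" if "z \<in> strip T" for n z
      using wE[of n] that by (simp add: E_def)
    fix \<eta> :: real assume \<eta>: "0 < \<eta>"
    define \<eta>' where "\<eta>' = \<eta> / (5 * D + 1)"
    have \<eta>': "0 < \<eta>'" "5 * D * \<eta>' \<le> \<eta>"
      using \<eta> D_nonneg by (auto simp: \<eta>'_def field_simps)
    note Cauchy = coefficients_uniformly_Cauchy[OF v_cont vM \<open>uniformly_convergent_on (strip T) v\<close> _ \<eta>'(1)]
    obtain n1 n2 where
      n1: "\<forall>n\<ge>n1. \<forall>m\<ge>n1. \<forall>z\<in>strip T.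
        \<bar>Fv (v n z, displacement (v n) z) - Fv (v m z, displacement (v m) z)\<bar> \<le> \<eta>'" and
      n2: "\<forall>n\<ge>n2. \<forall>m\<ge>n2. \<forall>z\<in>strip T.
        \<bar>Fu (v n z, displacement (v n) z) - Fu (v m z, displacement (v m) z)\<bar> \<le> \<eta>'"
      using Cauchy[OF _ Fv_Fu_continuous(1)] Cauchy[OF _ Fv_Fu_continuous(2)] by blast
    show "\<exists>n\<^sub>0. \<forall>n\<ge>n\<^sub>0. \<forall>m\<ge>n\<^sub>0. \<forall>k\<ge>0. (\<forall>z\<in>strip T. \<bar>w n z - w m z\<bar> \<le> k * E z) \<longrightarrow>
        (\<forall>z\<in>strip T. \<bar>w (Suc n) z - w (Suc m) z\<bar> \<le> (k / 2 + \<eta>) * E z)"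
    proof (intro exI[of _ "max n1 n2"] allI impI ballI)
      fix n m k z assume le: "\<forall>z\<in>strip T. \<bar>w n z - w m z\<bar> \<le> k * E z" and z: "z \<in> strip T"
        and nm: "max n1 n2 \<le> n" "max n1 n2 \<le> m"
      have "\<bar>w (Suc n) z - w (Suc m) z\<bar> \<le> (k / 2 + 5 * D * \<eta>') * E z"
        using le nm n1 n2 wE unfolding w_Suc E_def
        by (intro velocity_x_asymptotically_contracts[OF L L0 \<mu>_def v_cont vM v_cont w_cont w_cont _ _ _ _ z])
          auto
      also have "\<dots> \<le> (k / 2 + \<eta>) * E z"
        using E(1)[OF z] \<eta>'(2) by (intro mult_right_mono) auto
      finally show "\<bar>w (Suc n) z - w (Suc m) z\<bar> \<le> (k / 2 + \<eta>) * E z" .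
    qed
  qed (use E in auto)
  ultimately obtain v' w' where
    v': "uniform_limit (strip T) v v' sequentially" and w': "uniform_limit (strip T) w w' sequentially"
    by (auto simp: uniformly_convergent_on_def)
  have v'_cont: "continuous_on (strip T) v'" and w'_cont: "continuous_on (strip T) w'"
    using v_cont w_cont
    by (auto intro!: uniform_limit_theorem[OF _ v'] uniform_limit_theorem[OF _ w'])
  have lim: "(\<lambda>n. v n z) \<longlonglongrightarrow> v' z" if "z \<in> strip T" for z
    by (rule tendsto_uniform_limitI[OF v' that])
  have v'_x: "((\<lambda>y. v' (y, t)) has_real_derivative w' (x, t)) (at x)" if t: "t \<in> {0..T}" for x t
  proof -
    have mem: "(y, t) \<in> strip T" for y using t by (simp add: strip_def)
    have "\<exists>g. \<forall>y\<in>UNIV. (\<lambda>n. v n (y, t)) \<longlonglongrightarrow> g y \<and>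
        (g has_derivative (\<lambda>d. w' (y, t) * d)) (at y within UNIV)"
    proof (rule has_derivative_sequence[where f' = "\<lambda>n y d. w n (y, t) * d"])
      show "((\<lambda>y. v n (y, t)) has_derivative (\<lambda>d. w n (y, t) * d)) (at y within UNIV)" for n y
        using v_x[OF t, of n y] by (simp add: has_field_derivative_def)
      show "\<forall>\<^sub>F n in sequentially. \<forall>y\<in>UNIV. \<forall>d. norm (w n (y, t) * d - w' (y, t) * d) \<le> e * norm d"
        if "0 < e" for e
        using uniform_limitD[OF w' that]
      proof eventually_elim
        case (elim n)
        have "\<bar>w n (y, t) - w' (y, t)\<bar> * \<bar>d\<bar> \<le> e * \<bar>d\<bar>" for y d
          using elim mem[of y] by (intro mult_right_mono) (auto simp: dist_real_def less_imp_le)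
        then show ?case
          by (simp add: abs_mult flip: left_diff_distrib)
      qed
      show "(\<lambda>n. v n (0, t)) \<longlonglongrightarrow> v' (0, t)" using lim[OF mem] .
    qed auto
    then obtain g where g: "\<And>y. (\<lambda>n. v n (y, t)) \<longlonglongrightarrow> g y"
      "\<And>y. (g has_derivative (\<lambda>d. w' (y, t) * d)) (at y)"
      by auto
    have "g = (\<lambda>y. v' (y, t))"
      using LIMSEQ_unique[OF g(1) lim[OF mem]] by auto
    with g(2)[of x] show ?thesis by (simp add: has_field_derivative_def)
  qed
  have v'M: "\<bar>v' z\<bar> \<le> M" if "z \<in> strip T" for z
    using vM[OF that] by (intro LIMSEQ_le_const2[OF tendsto_rabs[OF lim[OF that]]]) auto
  have "velocity v' z = v' z" if z: "z \<in> strip T" for z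
  proof (rule LIMSEQ_unique)
    show "(\<lambda>n. velocity (v n) z) \<longlonglongrightarrow> v' z"
      using LIMSEQ_Suc[OF lim[OF z]] by (simp add: v_Suc)
    show "(\<lambda>n. velocity (v n) z) \<longlonglongrightarrow> velocity v' z"
    proof (rule tendstoI)
      fix e :: real assume "0 < e"
      then have "0 < e / E z" using E(2)[OF z] by (intro divide_pos_pos) auto
      from uniform_limitD[OF v' this]
      show "\<forall>\<^sub>F n in sequentially. dist (velocity (v n) z) (velocity v' z) < e"
      proof eventually_elim
        case (elim n)
        have Ez: "E z = exp (\<mu> * snd z)" by (simp add: E_def)
        have "\<bar>velocity (v n) z - velocity v' z\<bar> \<le> (e / E z) / 2 * E z"
          unfolding Ez
        proof (rule velocity_contracts[OF L L0 \<mu>_def v_cont vM v'_cont v'M _ z])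
          fix y assume y: "y \<in> strip T"
          have "\<bar>v n y - v' y\<bar> \<le> e / E z * 1" using elim y by (auto simp: dist_real_def less_imp_le)
          also have "\<dots> \<le> e / E z * E y" using E(2)[OF y] \<open>0 < e / E z\<close> by (intro mult_left_mono) auto
          finally show "\<bar>v n y - v' y\<bar> \<le> e / exp (\<mu> * snd z) * exp (\<mu> * snd y)" by (simp add: E_def)
        qed
        also have "\<dots> < e" using \<open>0 < e\<close> E(2)[OF z] by simp
        finally show ?case by (simp add: dist_real_def)
      qed
    qed
  qed
  moreover have "C1_in_x T v' w'"
    using v'_cont w'_cont v'_x by (simp add: C1_in_x_def)
  ultimately show ?thesis by blast
qed

end

section \<open>Pointwise bounds away from and near the light cone\<close>

text \<open>A large bound \<open>\<alpha>\<close> that holds only during a short time is paid for that time, not for \<open>T\<close>.\<close>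
lemma transport_localized_bound:
  assumes S: "continuous_on (strip T) S" and t: "0 \<le> t" "t \<le> T" and ab: "a \<le> b"
    and nonneg: "0 \<le> \<alpha>" "0 \<le> \<beta>"
    and le: "\<And>s. 0 \<le> s \<Longrightarrow> s \<le> t \<Longrightarrow>
      \<bar>S (x + \<sigma> * (t - s), s)\<bar> \<le> \<beta> + (if s \<in> {a..b} then \<alpha> else 0)"
  shows "\<bar>transport \<sigma> S (x, t)\<bar> \<le> (b - a) * \<alpha> + T * \<beta>"
proof -
  have Int: "{0..t} \<inter> {a..b} = {max 0 a..min t b}" by auto
  have "(\<lambda>s. \<alpha>) integrable_on {0..t} \<inter> {a..b}" unfolding Int by (rule integrable_const_ivl)
  then have i: "(\<lambda>s. if s \<in> {a..b} then \<alpha> else 0) integrable_on {0..t}"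
    by (subst integrable_restrict_Int) (simp add: Int_commute)
  have "\<bar>transport \<sigma> S (x, t)\<bar> \<le> integral {0..t} (\<lambda>s. \<beta> + (if s \<in> {a..b} then \<alpha> else 0))"
    unfolding transport_def split_conv real_norm_def[symmetric]
    using le t by (intro integral_norm_bound_integral transport_path_integrable[OF S]
        integrable_add i integrable_const_ivl) auto
  also have "\<dots> = t * \<beta> + integral {0..t} (\<lambda>s. if s \<in> {a..b} then \<alpha> else 0)"
    using t by (subst integral_add[OF integrable_const_ivl i]) simp
  also have "integral {0..t} (\<lambda>s. if s \<in> {a..b} then \<alpha> else 0) = integral {max 0 a..min t b} (\<lambda>s. \<alpha>)"
    by (simp only: integral_restrict_Int Int_atLeastAtMost max.commute min.commute)
  also have "integral {max 0 a..min t b} (\<lambda>s. \<alpha>) \<le> (b - a) * \<alpha>"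
    using ab nonneg by (cases "max 0 a \<le> min t b") (auto intro!: mult_right_mono)
  also have "t * \<beta> \<le> T * \<beta>" using t nonneg by (intro mult_right_mono)
  finally show ?thesis by simp
qed

definition near_cone :: "real \<Rightarrow> real \<times> real \<Rightarrow> bool" where
  "near_cone R z \<longleftrightarrow> \<bar>\<bar>fst z\<bar> - snd z\<bar> \<le> R"

lemma near_cone_times:
  assumes "near_cone R (x, s)"
  shows "s \<in> {\<bar>x\<bar> - R..\<bar>x\<bar> + R}"
  using assms by (auto simp: near_cone_def)

lemma off_cone_characteristics:
  assumes "\<not> near_cone R (x, t)" and "0 \<le> t"
  shows "R < \<bar>x + t\<bar>" "R < \<bar>x - t\<bar>"
  using assms by (auto simp: near_cone_def)

text \<open>
  Along a characteristic one of \<open>x + t\<close>, \<open>x - t\<close> is constant, and off the cone both exceed \<open>R\<close> in absolute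
  value. The characteristic can therefore meet the neighbourhood of only one branch of the cone, and it does so
  transversally with relative speed \<open>2\<close>, in a time interval of length \<open>R\<close>.
\<close>
lemma off_cone_crossing_times:
  assumes "\<not> near_cone R (x, t)" and "0 \<le> s" "s \<le> t"
  shows "near_cone R (x + 1 * (t - s), s) \<Longrightarrow> s \<in> {(x + t - R) / 2..(x + t + R) / 2}"
    and "near_cone R (x + - 1 * (t - s), s) \<Longrightarrow> s \<in> {(t - x - R) / 2..(t - x + R) / 2}"
proof -
  show "s \<in> {(x + t - R) / 2..(x + t + R) / 2}" if "near_cone R (x + 1 * (t - s), s)"
  proof -
    have "\<bar>\<bar>x + t - s\<bar> - s\<bar> \<le> R" "R < \<bar>x + t\<bar>"
      using that off_cone_characteristics(1)[OF assms(1)] assms by (auto simp: near_cone_def algebra_simps)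
    then have "x + t - R \<le> 2 * s" "2 * s \<le> x + t + R"
      using assms(2) by argo+
    then show ?thesis by simp
  qed
  show "s \<in> {(t - x - R) / 2..(t - x + R) / 2}" if "near_cone R (x + - 1 * (t - s), s)"
  proof -
    have "\<bar>\<bar>x - t + s\<bar> - s\<bar> \<le> R" "R < \<bar>x - t\<bar>"
      using that off_cone_characteristics(2)[OF assms(1)] assms by (auto simp: near_cone_def algebra_simps)
    then have "t - x - R \<le> 2 * s" "2 * s \<le> t - x + R"
      using assms(2) by argo+
    then show ?thesis by simp
  qed
qed

definition cone_weight :: "real \<Rightarrow> real \<Rightarrow> real \<Rightarrow> real \<times> real \<Rightarrow> real" where
  "cone_weight R P Q z = (if near_cone R z then P else Q)"

text \<open>
  The source is at most \<open>\<alpha> + \<beta>\<close> near the cone and \<open>\<beta>\<close> off it. Near the cone the data and the whole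
  length \<open>T\<close> of the characteristics count; off the cone the data vanish and \<open>\<alpha>\<close> acts only during the crossing.
\<close>
lemma (in semilinear_wave) velocity_preserves_cone_weight:
  assumes F_le: "\<And>a b. \<bar>F (a, b)\<bar> \<le> A * \<bar>a\<bar> powr p * \<bar>b\<bar> powr q + B * \<bar>b\<bar> powr r"
    and pos: "0 \<le> A" "0 \<le> B" "0 \<le> p" "0 \<le> q" "0 \<le> r" "0 \<le> R" "0 \<le> P" "0 \<le> Q"
    and supp: "\<And>x. R < \<bar>x\<bar> \<Longrightarrow> \<phi> x = 0" "\<And>x. R < \<bar>x\<bar> \<Longrightarrow> \<psi> x = 0"
    and data: "\<And>x. \<bar>h x\<bar> \<le> H" "\<And>x. \<bar>\<phi> x\<bar> \<le> V" "\<And>x. \<bar>\<psi> x\<bar> \<le> V"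
    and \<alpha>: "\<alpha> = A * P powr p * N powr q" and \<beta>: "\<beta> = A * Q powr p * N powr q + B * N powr r"
    and N: "H + 2 * R * P + T * Q \<le> N"
    and near: "V + T * (\<alpha> + \<beta>) \<le> P" and off: "R * \<alpha> + T * \<beta> \<le> Q"
    and v: "continuous_on (strip T) v" and v_le: "\<forall>z\<in>strip T. \<bar>v z\<bar> \<le> cone_weight R P Q z"
  shows "\<forall>z\<in>strip T. \<bar>velocity v z\<bar> \<le> cone_weight R P Q z"
proof -
  have \<alpha>\<beta>: "0 \<le> \<alpha>" "0 \<le> \<beta>" using pos by (simp_all add: \<alpha> \<beta>)
  have disp: "\<bar>displacement v (x, t)\<bar> \<le> N" if t: "t \<in> {0..T}" for x t
  proof -
    have "\<bar>transport 0 v (x, t)\<bar> \<le> (\<bar>x\<bar> + R - (\<bar>x\<bar> - R)) * P + T * Q"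
    proof (rule transport_localized_bound[OF v])
      fix s assume "0 \<le> s" "s \<le> t"
      then have "\<bar>v (x, s)\<bar> \<le> cone_weight R P Q (x, s)" using v_le t by (auto simp: strip_def)
      then show "\<bar>v (x + 0 * (t - s), s)\<bar> \<le> Q + (if s \<in> {\<bar>x\<bar> - R..\<bar>x\<bar> + R} then P else 0)"
        using near_cone_times[of R x s] pos by (auto simp: cone_weight_def split: if_splits)
    qed (use t pos in auto)
    then show ?thesis using data(1)[of x] N by (simp add: displacement_def)
  qed
  have src: "\<bar>source v z\<bar> \<le> \<beta> + (if near_cone R z then \<alpha> else 0)" if z: "z \<in> strip T" for z
  proof -
    have d: "\<bar>displacement v z\<bar> \<le> N" using disp z by (auto simp: strip_def)
    have "\<bar>source v z\<bar> \<le> A * \<bar>v z\<bar> powr p * \<bar>displacement v z\<bar> powr q + B * \<bar>displacement v z\<bar> powr r"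
      unfolding source_def by (rule F_le)
    also have "\<dots> \<le> A * cone_weight R P Q z powr p * N powr q + B * N powr r"
      using pos v_le d z by (intro add_mono mult_mono powr_mono2) auto
    also have "\<dots> \<le> \<beta> + (if near_cone R z then \<alpha> else 0)"
      using pos by (auto simp: cone_weight_def \<alpha> \<beta>)
    finally show ?thesis .
  qed
  have path_src: "\<bar>source v (x + \<sigma> * (t - s), s)\<bar> \<le> \<beta> + (if s \<in> {a..b} then \<alpha> else 0)"
    if "0 \<le> s" "s \<le> t" "t \<le> T" "near_cone R (x + \<sigma> * (t - s), s) \<Longrightarrow> s \<in> {a..b}" for x t s \<sigma> a b
  proof -
    have "(x + \<sigma> * (t - s), s) \<in> strip T" using that by (auto simp: strip_def)
    from src[OF this] that(4) \<alpha>\<beta> show ?thesis by (auto split: if_splits)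
  qed
  note bound = transport_localized_bound[OF source_continuous[OF v] _ _ _ \<alpha>\<beta> path_src]
  have avg: "\<bar>(a + b + c + d) / 2\<bar> \<le> e + f"
    if "\<bar>a\<bar> \<le> e" "\<bar>b\<bar> \<le> e" "\<bar>c\<bar> \<le> f" "\<bar>d\<bar> \<le> f" for a b c d e f :: real
    using that by argo
  have "\<bar>velocity v (x, t)\<bar> \<le> cone_weight R P Q (x, t)" if t: "0 \<le> t" "t \<le> T" for x t
  proof (cases "near_cone R (x, t)")
    case True
    have "\<bar>transport \<sigma> (source v) (x, t)\<bar> \<le> T * (\<alpha> + \<beta>)" for \<sigma>
    proof -
      have "\<bar>transport \<sigma> (source v) (x, t)\<bar> \<le> (t - 0) * \<alpha> + T * \<beta>"
        by (rule bound) (use t in auto)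
      also have "\<dots> \<le> T * (\<alpha> + \<beta>)" using t \<alpha>\<beta> by (simp add: distrib_left mult_right_mono)
      finally show ?thesis .
    qed
    from avg[OF data(2,3) this this]
    have "\<bar>velocity v (x, t)\<bar> \<le> V + T * (\<alpha> + \<beta>)" unfolding dalembert_def by blast
    with near True show ?thesis by (simp add: cone_weight_def)
  next
    case False
    have "\<bar>transport 1 (source v) (x, t)\<bar> \<le> ((x + t + R) / 2 - (x + t - R) / 2) * \<alpha> + T * \<beta>"
      by (intro bound off_cone_crossing_times(1)[OF False]; (assumption | use t pos in \<open>simp add: field_simps\<close>))
    moreover have "\<bar>transport (- 1) (source v) (x, t)\<bar> \<le> ((t - x + R) / 2 - (t - x - R) / 2) * \<alpha> + T * \<beta>"
      by (intro bound off_cone_crossing_times(2)[OF False]; (assumption | use t pos in \<open>simp add: field_simps\<close>))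
    moreover have "\<phi> (x + t) = 0" "\<psi> (x - t) = 0"
      using supp off_cone_characteristics[OF False t(1)] by auto
    moreover have "(x + t + R) / 2 - (x + t - R) / 2 = R" "(t - x + R) / 2 - (t - x - R) / 2 = R"
      by argo+
    ultimately have "\<bar>velocity v (x, t)\<bar> \<le> 0 + (R * \<alpha> + T * \<beta>)"
      using avg[of "\<phi> (x + t)" 0 "\<psi> (x - t)"] unfolding dalembert_def by simp
    with off False show ?thesis by (simp add: cone_weight_def)
  qed
  then show ?thesis by (auto simp: strip_def)
qed

text \<open>
  The constants must be chosen in the order \<open>M\<close>, \<open>N\<close>, \<open>K\<close>, \<open>c\<close>. The crossing term \<open>R C1\<close>, which \<open>c\<close> does not make
  small, has to be absorbed by \<open>K\<close>, and \<open>C1\<close> depends on \<open>N\<close>; this is not circular because the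
  contribution of \<open>K\<close> to \<open>N\<close> carries the factor \<open>c\<close> and is bounded in advance by \<open>1\<close>.
\<close>
lemma bootstrap_constants:
  fixes p q r A B R m F\<^sub>0 V\<^sub>0 :: real
  assumes p: "1 < p" and q: "1 < q" and r: "1 < r" and A: "0 < A" and B: "0 < B" and R: "0 \<le> R"
    and F0: "0 \<le> F\<^sub>0" and V0: "0 \<le> V\<^sub>0"
    and m: "1 < m" "m \<le> p + q" "2 * m - 1 \<le> r"
  obtains M N K c :: real where "0 < M" "0 < N" "0 < K" "0 < c"
    "\<And>\<epsilon> T \<alpha> \<beta>. \<lbrakk>0 < \<epsilon>; \<epsilon> \<le> 1; 0 < T; T \<le> c * \<epsilon> powr (1 - m);
      \<alpha> = A * (M * \<epsilon>) powr p * (N * \<epsilon>) powr q;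
      \<beta> = A * (K * \<epsilon> powr m) powr p * (N * \<epsilon>) powr q + B * (N * \<epsilon>) powr r\<rbrakk> \<Longrightarrow>
      F\<^sub>0 * \<epsilon> + 2 * R * (M * \<epsilon>) + T * (K * \<epsilon> powr m) \<le> N * \<epsilon> \<and>
      V\<^sub>0 * \<epsilon> + T * (\<alpha> + \<beta>) \<le> M * \<epsilon> \<and>
      R * \<alpha> + T * \<beta> \<le> K * \<epsilon> powr m"
proof -
  define M where "M = V\<^sub>0 + 1"
  define N where "N = F\<^sub>0 + 2 * R * M + 1"
  define C1 where "C1 = A * M powr p * N powr q"
  define K where "K = R * C1 + 1"
  define C2 where "C2 = A * K powr p * N powr q"
  define C3 where "C3 = B * N powr r"
  define c where "c = 1 / (K + C1 + C2 + C3)"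
  have M: "0 < M" using V0 by (simp add: M_def)
  have N: "0 < N" using F0 R M by (simp add: N_def add_nonneg_pos)
  have C1: "0 < C1" using A M N by (simp add: C1_def)
  have K: "0 < K" using R C1 by (simp add: K_def add_nonneg_pos)
  have C2: "0 < C2" using A K N by (simp add: C2_def)
  have C3: "0 < C3" using B N by (simp add: C3_def)
  have c: "0 < c" using K C1 C2 C3 by (simp add: c_def)
  have "c * (K + C1 + C2 + C3) = 1" using K C1 C2 C3 by (simp add: c_def)
  then have c_sum: "c * K + c * C1 + c * C2 + c * C3 = 1" by (simp add: algebra_simps)
  have cpos: "0 \<le> c * K" "0 \<le> c * C1" "0 \<le> c * C2" "0 \<le> c * C3" using c K C1 C2 C3 by simp_all
  \<comment> \<open>off the cone the factor \<open>\<bar>v\<bar> powr p\<close> improves on the case \<open>p = 1\<close>\<close>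
  have "0 \<le> (p - 1) * (m - 1)" using p m by simp
  then have exponent: "2 * m - 1 \<le> p * m + q" using m by (simp add: algebra_simps)
  show thesis
  proof (rule that[OF M N K c])
    fix \<epsilon> T \<alpha> \<beta>
    assume \<epsilon>: "0 < \<epsilon>" "\<epsilon> \<le> 1" and T: "0 < T" "T \<le> c * \<epsilon> powr (1 - m)"
      and \<alpha>: "\<alpha> = A * (M * \<epsilon>) powr p * (N * \<epsilon>) powr q"
      and \<beta>: "\<beta> = A * (K * \<epsilon> powr m) powr p * (N * \<epsilon>) powr q + B * (N * \<epsilon>) powr r"
    \<comment> \<open>the factor \<open>T\<close> costs the power \<open>m - 1\<close> of \<open>\<epsilon>\<close>\<close>
    have time: "T * \<epsilon> powr s \<le> c * \<epsilon> powr d" if "d + m - 1 \<le> s" for s d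
    proof -
      have "T * \<epsilon> powr s \<le> c * \<epsilon> powr (1 - m) * \<epsilon> powr s"
        using T by (intro mult_right_mono) auto
      also have "\<dots> = c * \<epsilon> powr (1 - m + s)" by (simp add: powr_add)
      also have "\<dots> \<le> c * \<epsilon> powr d"
        using c \<epsilon> that by (intro mult_left_mono powr_mono') auto
      finally show ?thesis .
    qed
    have \<alpha>': "\<alpha> = C1 * \<epsilon> powr (p + q)"
      using M N \<epsilon> by (simp add: \<alpha> C1_def powr_mult powr_add)
    have \<beta>': "\<beta> = C2 * \<epsilon> powr (p * m + q) + C3 * \<epsilon> powr r"
      using K N \<epsilon> by (simp add: \<beta> C2_def C3_def powr_mult powr_add powr_powr mult.commute)
    have em: "\<epsilon> powr m \<le> \<epsilon>" using powr_mono'[of 1 m \<epsilon>] m \<epsilon> by simp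
    have epq: "\<epsilon> powr (p + q) \<le> \<epsilon> powr m" using m \<epsilon> by (intro powr_mono') auto
    have T\<alpha>: "T * \<alpha> \<le> c * C1 * \<epsilon>"
      using mult_left_mono[OF time[of 1 "p + q"], of C1] C1 m \<epsilon> by (simp add: \<alpha>' algebra_simps)
    have "T * \<beta> = C2 * (T * \<epsilon> powr (p * m + q)) + C3 * (T * \<epsilon> powr r)"
      by (simp add: \<beta>' algebra_simps)
    also have "\<dots> \<le> C2 * (c * \<epsilon> powr m) + C3 * (c * \<epsilon> powr m)"
      using C2 C3 m exponent by (intro add_mono mult_left_mono time) auto
    also have "\<dots> = (c * C2 + c * C3) * \<epsilon> powr m" by (simp add: algebra_simps)
    finally have T\<beta>: "T * \<beta> \<le> (c * C2 + c * C3) * \<epsilon> powr m" .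
    have "T * (K * \<epsilon> powr m) \<le> c * K * \<epsilon>"
      using mult_left_mono[OF time[of 1 m], of K] K \<epsilon> by (simp add: algebra_simps)
    also have "\<dots> \<le> 1 * \<epsilon>" using c_sum cpos \<epsilon> by (intro mult_right_mono) linarith+
    finally have 1: "F\<^sub>0 * \<epsilon> + 2 * R * (M * \<epsilon>) + T * (K * \<epsilon> powr m) \<le> N * \<epsilon>"
      by (simp add: N_def algebra_simps)
    have "(c * C2 + c * C3) * \<epsilon> powr m \<le> (c * C2 + c * C3) * \<epsilon>"
      using em cpos by (intro mult_left_mono) auto
    with T\<alpha> T\<beta> have "T * (\<alpha> + \<beta>) \<le> (c * C1 + c * C2 + c * C3) * \<epsilon>"
      by (simp add: algebra_simps)
    also have "\<dots> \<le> 1 * \<epsilon>" using c_sum cpos \<epsilon> by (intro mult_right_mono) linarith+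
    finally have 2: "V\<^sub>0 * \<epsilon> + T * (\<alpha> + \<beta>) \<le> M * \<epsilon>" by (simp add: M_def algebra_simps)
    have "R * \<alpha> \<le> R * C1 * \<epsilon> powr m"
      using mult_left_mono[OF epq, of "R * C1"] R C1 by (simp add: \<alpha>' mult.assoc)
    moreover have "(c * C2 + c * C3) * \<epsilon> powr m \<le> 1 * \<epsilon> powr m"
      using c_sum cpos by (intro mult_right_mono) auto
    ultimately have 3: "R * \<alpha> + T * \<beta> \<le> K * \<epsilon> powr m"
      using T\<beta> by (simp add: K_def algebra_simps)
    from 1 2 3 show "F\<^sub>0 * \<epsilon> + 2 * R * (M * \<epsilon>) + T * (K * \<epsilon> powr m) \<le> N * \<epsilon> \<and>
      V\<^sub>0 * \<epsilon> + T * (\<alpha> + \<beta>) \<le> M * \<epsilon> \<and> R * \<alpha> + T * \<beta> \<le> K * \<epsilon> powr m"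
      by blast
  qed
qed

section \<open>Powers and initial data\<close>

text \<open>Up to a factor, the derivative of an even power \<open>\<bar>x\<bar> powr (a + 1)\<close>.\<close>
definition odd_power :: "real \<Rightarrow> real \<Rightarrow> real" where
  "odd_power a x = \<bar>x\<bar> powr a * sgn x"

lemma odd_power_continuous:
  assumes "0 < a"
  shows "continuous_on UNIV (odd_power a)"
proof -
  have "odd_power a = (\<lambda>x. max 0 x powr a - max 0 (- x) powr a)"
    using assms by (auto simp: odd_power_def fun_eq_iff sgn_if max_def)
  moreover have "continuous_on UNIV (\<lambda>x::real. max 0 x powr a - max 0 (- x) powr a)"
    using assms by (intro continuous_on_diff continuous_on_powr' continuous_intros) auto
  ultimately show ?thesis by simp
qed

lemma abs_powr_continuous:
  assumes "0 < a"
  shows "continuous_on UNIV (\<lambda>x::real. \<bar>x\<bar> powr a)"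
  using assms by (intro continuous_on_powr' continuous_intros) auto

lemma abs_powr_has_derivative:
  assumes a: "1 < a"
  shows "((\<lambda>x. \<bar>x\<bar> powr a) has_real_derivative a * odd_power (a - 1) x) (at x)"
proof (cases x "0::real" rule: linorder_cases)
  case greater
  have "((\<lambda>x. x powr a) has_real_derivative a * odd_power (a - 1) x) (at x)"
    using has_real_derivative_powr[OF greater, of a] greater by (simp add: odd_power_def)
  then show ?thesis
    by (rule has_field_derivative_transform_within_open[where S = "{0<..}"]) (use greater in auto)
next
  case less
  have "((\<lambda>x. - x) has_real_derivative - 1) (at x)"
    by (auto intro!: derivative_eq_intros)
  from DERIV_chain2[OF has_real_derivative_powr this, of a] less
  have "((\<lambda>x. (- x) powr a) has_real_derivative a * odd_power (a - 1) x) (at x)"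
    by (simp add: odd_power_def)
  then show ?thesis
    by (rule has_field_derivative_transform_within_open[where S = "{..<0}"]) (use less in auto)
next
  case equal
  have "isCont (\<lambda>h::real. \<bar>h\<bar> powr (a - 1)) 0"
    using abs_powr_continuous[of "a - 1"] a by (simp add: continuous_on_eq_continuous_at)
  then have "((\<lambda>h::real. \<bar>h\<bar> powr (a - 1)) \<longlongrightarrow> \<bar>0\<bar> powr (a - 1)) (at 0)"
    by (simp only: isCont_def)
  then have "((\<lambda>h::real. \<bar>h\<bar> powr (a - 1)) \<longlongrightarrow> 0) (at 0)" by simp
  then have "((\<lambda>h. (\<bar>0 + h\<bar> powr a - \<bar>0\<bar> powr a) / h) \<longlongrightarrow> 0) (at (0::real))"
    by (rule Lim_null_comparison[rotated])
      (auto simp: eventually_at_filter powr_diff)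
  with equal show ?thesis by (simp add: DERIV_def odd_power_def)
qed

lemma nonlinearity_has_derivative:
  fixes A B p q r :: real
  assumes "1 < p" "1 < q" "1 < r"
  shows "((\<lambda>z. A * \<bar>fst z\<bar> powr p * \<bar>snd z\<bar> powr q + B * \<bar>snd z\<bar> powr r) has_derivative
    (\<lambda>d. (A * (p * odd_power (p - 1) (fst z)) * \<bar>snd z\<bar> powr q) * fst d
      + (A * \<bar>fst z\<bar> powr p * (q * odd_power (q - 1) (snd z))
         + B * (r * odd_power (r - 1) (snd z))) * snd d)) (at z)"
proof -
  have fst_D: "((\<lambda>z. \<bar>fst z\<bar> powr a) has_derivative (\<lambda>d. a * odd_power (a - 1) (fst z) * fst d)) (at z)"
    and snd_D: "((\<lambda>z. \<bar>snd z\<bar> powr a) has_derivative (\<lambda>d. a * odd_power (a - 1) (snd z) * snd d)) (at z)"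
    if "1 < a" for a and z :: "real \<times> real"
    using has_derivative_compose[OF has_derivative_fst[OF has_derivative_ident]
        abs_powr_has_derivative[OF that, of "fst z", unfolded has_field_derivative_def]]
      has_derivative_compose[OF has_derivative_snd[OF has_derivative_ident]
        abs_powr_has_derivative[OF that, of "snd z", unfolded has_field_derivative_def]]
    by auto
  note D = has_derivative_add[OF
      has_derivative_mult[OF has_derivative_mult[OF has_derivative_const[of A] fst_D[OF assms(1)]] snd_D[OF assms(2)]]
      has_derivative_mult[OF has_derivative_const[of B] snd_D[OF assms(3)]]]
  show ?thesis
    by (rule has_derivative_eq_rhs[OF D]) (simp add: fun_eq_iff algebra_simps)
qed

lemma vanishes_off_support:
  assumes "supp f \<subseteq> {x. \<bar>x\<bar> \<le> R}" "R < \<bar>x\<bar>"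
  shows "f x = 0"
  using assms closure_subset[of "{x. f x \<noteq> 0}"] unfolding supp_def by force

text \<open>The exterior of the support is open, so vanishing passes to derivatives.\<close>
lemma deriv_vanishes:
  assumes "\<And>x. R < \<bar>x\<bar> \<Longrightarrow> f x = 0" and x: "R < \<bar>x\<bar>"
  shows "deriv f x = (0::real)"
proof -
  have "open {x::real. R < \<bar>x\<bar>}" by (intro open_Collect_less continuous_intros)
  then have "(f has_real_derivative 0) (at x)"
    by (rule has_field_derivative_transform_within_open[where f = "\<lambda>_. 0", rotated])
      (use assms in auto)
  then show ?thesis by (rule DERIV_imp_deriv)
qed

lemma bounded_of_continuous_vanishing:
  fixes f :: "real \<Rightarrow> real"
  assumes "continuous_on UNIV f" and "\<And>x. R < \<bar>x\<bar> \<Longrightarrow> f x = 0"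
  shows "\<exists>D\<ge>0. \<forall>x. \<bar>f x\<bar> \<le> D"
proof -
  have "bounded (f ` {- R..R})"
    by (intro compact_imp_bounded compact_continuous_image continuous_on_subset[OF assms(1)]) auto
  then obtain D where "\<forall>y\<in>f ` {- R..R}. norm y \<le> D" unfolding bounded_iff by blast
  then have D: "\<bar>f x\<bar> \<le> D" if "x \<in> {- R..R}" for x using that by auto
  have "\<bar>f x\<bar> \<le> max 0 D" for x
    using D[of x] assms(2)[of x] by (cases "x \<in> {- R..R}") (auto simp: le_max_iff_disj)
  then show ?thesis by (intro exI[of _ "max 0 D"]) auto
qed

lemma C0k_2_derivatives:
  assumes "C0k 2 f"
  shows "(f has_real_derivative deriv f x) (at x)"
    and "(deriv f has_real_derivative deriv (deriv f) x) (at x)"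
    and "continuous_on UNIV f" "continuous_on UNIV (deriv f)" "continuous_on UNIV (deriv (deriv f))"
proof -
  have d: "\<forall>j<2. \<forall>x. (deriv ^^ j) f differentiable (at x)"
    and c: "\<forall>j\<le>2. continuous_on UNIV ((deriv ^^ j) f)"
    using assms by (auto simp: C0k_def Ck_def)
  show "(f has_real_derivative deriv f x) (at x)"
    using d[rule_format, of 0 x] by (simp add: DERIV_deriv_iff_real_differentiable)
  show "(deriv f has_real_derivative deriv (deriv f) x) (at x)"
    using d[rule_format, of 1 x] by (simp add: DERIV_deriv_iff_real_differentiable)
  show "continuous_on UNIV f" "continuous_on UNIV (deriv f)" "continuous_on UNIV (deriv (deriv f))"
    using c[rule_format, of 0] c[rule_format, of 1] c[rule_format, of 2]
    by (simp_all add: numeral_2_eq_2)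
qed

lemma C0k_1_derivatives:
  assumes "C0k 1 g"
  shows "(g has_real_derivative deriv g x) (at x)"
    and "continuous_on UNIV g" "continuous_on UNIV (deriv g)"
proof -
  have d: "\<forall>j<1. \<forall>x. (deriv ^^ j) g differentiable (at x)"
    and c: "\<forall>j\<le>1. continuous_on UNIV ((deriv ^^ j) g)"
    using assms by (auto simp: C0k_def Ck_def)
  show "(g has_real_derivative deriv g x) (at x)"
    using d[rule_format, of 0 x] by (simp add: DERIV_deriv_iff_real_differentiable)
  show "continuous_on UNIV g" "continuous_on UNIV (deriv g)"
    using c[rule_format, of 0] c[rule_format, of 1] by simp_all
qed

section \<open>Existence up to the lifespan bound\<close>

text \<open>
  Two bounds of the data are in play: the size \<open>D \<epsilon>\<close> of the initial values drives the bootstrap, while for their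
  derivatives, which affect only the regularity of the solution, the crude bound \<open>D\<close> suffices.
\<close>
lemma existence_up_to_lifespan:
  fixes p q r A B R m :: real and f g :: "real \<Rightarrow> real"
  assumes p: "1 < p" and q: "1 < q" and r: "1 < r" and A: "0 < A" and B: "0 < B" and R: "0 \<le> R"
    and f: "C0k 2 f" and g: "C0k 1 g"
    and supp: "supp f \<subseteq> {x. \<bar>x\<bar> \<le> R}" "supp g \<subseteq> {x. \<bar>x\<bar> \<le> R}"
    and m: "1 < m" "m \<le> p + q" "2 * m - 1 \<le> r"
  shows "\<exists>c>0. \<forall>\<epsilon> T. 0 < \<epsilon> \<longrightarrow> \<epsilon> \<le> 1 \<longrightarrow> 0 < T \<longrightarrow> T \<le> c * \<epsilon> powr (1 - m) \<longrightarrow>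
    (\<exists>u. classical_solution p q r A B f g \<epsilon> T u)"
proof -
  note f' = C0k_2_derivatives[OF f] and g' = C0k_1_derivatives[OF g]
  have f0: "f x = 0" and g0: "g x = 0" if "R < \<bar>x\<bar>" for x
    using vanishes_off_support supp that by blast+
  have f1: "deriv f x = 0" and g1: "deriv g x = 0" if "R < \<bar>x\<bar>" for x
    using deriv_vanishes[of R] f0 g0 that by blast+
  have f2: "deriv (deriv f) x = 0" if "R < \<bar>x\<bar>" for x
    using deriv_vanishes[of R] f1 that by blast
  obtain D0 D1 D2 D3 D4 where
    D0: "D0 \<ge> 0" "\<And>x. \<bar>f x\<bar> \<le> D0" and D1: "D1 \<ge> 0" "\<And>x. \<bar>deriv f x\<bar> \<le> D1" and
    D2: "D2 \<ge> 0" "\<And>x. \<bar>deriv (deriv f) x\<bar> \<le> D2" and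
    D3: "D3 \<ge> 0" "\<And>x. \<bar>g x\<bar> \<le> D3" and D4: "D4 \<ge> 0" "\<And>x. \<bar>deriv g x\<bar> \<le> D4"
    using bounded_of_continuous_vanishing[OF f'(3) f0] bounded_of_continuous_vanishing[OF f'(4) f1]
      bounded_of_continuous_vanishing[OF f'(5) f2] bounded_of_continuous_vanishing[OF g'(2) g0]
      bounded_of_continuous_vanishing[OF g'(3) g1] by metis
  define D where "D = D0 + D1 + D2 + D3 + D4"
  have D: "0 \<le> D" "\<bar>f x\<bar> \<le> D" "\<bar>deriv f x\<bar> \<le> D"
    "\<bar>deriv f x + g x\<bar> \<le> D" "\<bar>g x - deriv f x\<bar> \<le> D"
    "\<bar>deriv (deriv f) x + deriv g x\<bar> \<le> D" "\<bar>deriv g x - deriv (deriv f) x\<bar> \<le> D" for x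
    using D0 D1 D2 D3 D4 D0(2)[of x] D1(2)[of x] D2(2)[of x] D3(2)[of x] D4(2)[of x]
    unfolding D_def by linarith+
  obtain M N K c where pos: "0 < M" "0 < N" "0 < K" "0 < c" and boot:
    "\<And>\<epsilon> T \<alpha> \<beta>. \<lbrakk>0 < \<epsilon>; \<epsilon> \<le> 1; 0 < T; T \<le> c * \<epsilon> powr (1 - m);
      \<alpha> = A * (M * \<epsilon>) powr p * (N * \<epsilon>) powr q;
      \<beta> = A * (K * \<epsilon> powr m) powr p * (N * \<epsilon>) powr q + B * (N * \<epsilon>) powr r\<rbrakk> \<Longrightarrow>
      D * \<epsilon> + 2 * R * (M * \<epsilon>) + T * (K * \<epsilon> powr m) \<le> N * \<epsilon> \<and>
      D * \<epsilon> + T * (\<alpha> + \<beta>) \<le> M * \<epsilon> \<and> R * \<alpha> + T * \<beta> \<le> K * \<epsilon> powr m"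
    by (rule bootstrap_constants[OF p q r A B R D(1) D(1) m]) blast
  define F where "F = (\<lambda>z. A * \<bar>fst z\<bar> powr p * \<bar>snd z\<bar> powr q + B * \<bar>snd z\<bar> powr r)"
  define Fv where "Fv = (\<lambda>z. A * (p * odd_power (p - 1) (fst z)) * \<bar>snd z\<bar> powr q)"
  define Fu where "Fu = (\<lambda>z. A * \<bar>fst z\<bar> powr p * (q * odd_power (q - 1) (snd z))
    + B * (r * odd_power (r - 1) (snd z)))"
  have "\<exists>u. classical_solution p q r A B f g \<epsilon> T u"
    if \<epsilon>: "0 < \<epsilon>" "\<epsilon> \<le> 1" and T: "0 < T" "T \<le> c * \<epsilon> powr (1 - m)" for \<epsilon> T
  proof -
    have scale: "\<bar>\<epsilon> * y\<bar> \<le> D * \<epsilon>" "\<bar>\<epsilon> * y\<bar> \<le> D" if "\<bar>y\<bar> \<le> D" for y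
    proof -
      show "\<bar>\<epsilon> * y\<bar> \<le> D * \<epsilon>" using that \<epsilon> by (simp add: abs_mult mult.commute)
      also have "D * \<epsilon> \<le> D" using \<epsilon> D(1) by (intro mult_left_le) auto
      finally show "\<bar>\<epsilon> * y\<bar> \<le> D" .
    qed
    interpret W: semilinear_wave T D F Fv Fu "\<lambda>x. \<epsilon> * f x" "\<lambda>x. \<epsilon> * deriv f x"
      "\<lambda>x. \<epsilon> * (deriv f x + g x)" "\<lambda>x. \<epsilon> * (deriv (deriv f) x + deriv g x)"
      "\<lambda>x. \<epsilon> * (g x - deriv f x)" "\<lambda>x. \<epsilon> * (deriv g x - deriv (deriv f) x)"
    proof
      show "(F has_derivative (\<lambda>d. Fv z * fst d + Fu z * snd d)) (at z)" for z
        unfolding F_def Fv_def Fu_def by (rule nonlinearity_has_derivative[OF p q r])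
      show "continuous_on UNIV Fv" "continuous_on UNIV Fu"
        unfolding Fv_def Fu_def using p q r
        by (intro continuous_intros
            continuous_on_compose2[OF odd_power_continuous] continuous_on_compose2[OF abs_powr_continuous]; simp)+
      show "((\<lambda>x. \<epsilon> * f x) has_real_derivative \<epsilon> * deriv f x) (at x)"
        "((\<lambda>x. \<epsilon> * (deriv f x + g x)) has_real_derivative \<epsilon> * (deriv (deriv f) x + deriv g x)) (at x)"
        "((\<lambda>x. \<epsilon> * (g x - deriv f x)) has_real_derivative \<epsilon> * (deriv g x - deriv (deriv f) x)) (at x)" for x
        by (intro DERIV_cmult DERIV_add DERIV_diff f' g')+
      show "continuous_on UNIV (\<lambda>x. \<epsilon> * deriv f x)"
        "continuous_on UNIV (\<lambda>x. \<epsilon> * (deriv (deriv f) x + deriv g x))"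
        "continuous_on UNIV (\<lambda>x. \<epsilon> * (deriv g x - deriv (deriv f) x))"
        by (intro continuous_intros f' g')+
      show "\<bar>\<epsilon> * f x\<bar> \<le> D" "\<bar>\<epsilon> * deriv f x\<bar> \<le> D"
        "\<bar>\<epsilon> * (deriv (deriv f) x + deriv g x)\<bar> \<le> D" "\<bar>\<epsilon> * (deriv g x - deriv (deriv f) x)\<bar> \<le> D" for x
        by (intro scale D)+
      show "\<epsilon> * (deriv f x + g x) - \<epsilon> * (g x - deriv f x) = 2 * (\<epsilon> * deriv f x)" for x
        by (simp add: algebra_simps)
    qed (rule T(1))
    define P where "P = M * \<epsilon>"
    define Q where "Q = K * \<epsilon> powr m"
    have PQ: "0 \<le> P" "0 \<le> Q" using pos \<epsilon> by (simp_all add: P_def Q_def)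
    define \<alpha> where "\<alpha> = A * P powr p * (N * \<epsilon>) powr q"
    define \<beta> where "\<beta> = A * Q powr p * (N * \<epsilon>) powr q + B * (N * \<epsilon>) powr r"
    have b: "D * \<epsilon> + 2 * R * P + T * Q \<le> N * \<epsilon>" "D * \<epsilon> + T * (\<alpha> + \<beta>) \<le> P" "R * \<alpha> + T * \<beta> \<le> Q"
      using boot[OF \<epsilon> T refl refl] unfolding P_def Q_def \<alpha>_def \<beta>_def by blast+
    have "\<exists>v w. C1_in_x T v w \<and> (\<forall>z\<in>strip T. W.velocity v z = v z)"
    proof (rule W.velocity_fixed_point[where W = "cone_weight R P Q" and M = "max P Q"])
      show "\<forall>z\<in>strip T. \<bar>W.velocity v z\<bar> \<le> cone_weight R P Q z"
        if "continuous_on (strip T) v" "\<forall>z\<in>strip T. \<bar>v z\<bar> \<le> cone_weight R P Q z" for v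
      proof (rule W.velocity_preserves_cone_weight[where A = A and B = B and p = p and q = q
            and r = r and N = "N * \<epsilon>" and H = "D * \<epsilon>" and V = "D * \<epsilon>", OF _ _ _ _ _ _ R PQ
            _ _ _ _ _ \<alpha>_def \<beta>_def b that])
        show "\<bar>F (a, b)\<bar> \<le> A * \<bar>a\<bar> powr p * \<bar>b\<bar> powr q + B * \<bar>b\<bar> powr r" for a b
          using A B by (simp add: F_def)
      qed (use A B p q r f0 f1 g0 scale D in auto)
    qed (use PQ in \<open>auto simp: cone_weight_def\<close>)
    then obtain v w where v: "C1_in_x T v w" and fp: "\<forall>z\<in>strip T. W.velocity v z = v z"
      by blast
    note sol = W.fixed_point_is_classical[OF v fp]
    have "classical_solution p q r A B f g \<epsilon> T (W.displacement v)"
      unfolding classical_solution_def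
    proof (intro conjI ballI allI)
      fix z assume z: "z \<in> strip T"
      then show "dt T (dt T (W.displacement v)) z - dx (dx (W.displacement v)) z =
          A * \<bar>dt T (W.displacement v) z\<bar> powr p * \<bar>W.displacement v z\<bar> powr q
            + B * \<bar>W.displacement v z\<bar> powr r"
        using sol(2,3) by (simp add: F_def)
    next
      fix x
      show "W.displacement v (x, 0) = \<epsilon> * f x"
        by (simp add: W.displacement_def transport_def)
      have "(x, 0) \<in> strip T" using T by (simp add: strip_def)
      then have "dt T (W.displacement v) (x, 0) = W.velocity v (x, 0)" using sol(2) fp by simp
      also have "\<dots> = \<epsilon> * g x" by (simp add: dalembert_def transport_def algebra_simps)
      finally show "dt T (W.displacement v) (x, 0) = \<epsilon> * g x" .
    qed (rule sol(1))
    then show ?thesis by blast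
  qed
  with \<open>0 < c\<close> show ?thesis by blast
qed

text \<open>
  The largest \<open>m\<close> with \<open>m \<le> p + q\<close> and \<open>2 m - 1 \<le> r\<close> gives the longest lifespan; the two cases
  record which of the constraints binds.
\<close>
theorem theorem2p1:
  fixes p q r A B R :: real and f g :: "real \<Rightarrow> real"
  assumes "p > 1" and "q > 1" and "r > 1"
    and "A > 0" and "B > 0" and "R \<ge> 1"
    and "C0k 2 f" and "C0k 1 g"
    and "supp f \<subseteq> {x. \<bar>x\<bar> \<le> R}" and "supp g \<subseteq> {x. \<bar>x\<bar> \<le> R}"
    and "integral UNIV g \<noteq> 0"
  shows "\<exists>\<epsilon>\<^sub>1 > 0. \<exists>c > 0. \<forall>\<epsilon>. 0 < \<epsilon> \<and> \<epsilon> \<le> \<epsilon>\<^sub>1 \<longrightarrow>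
    (\<forall>T > 0.
      (p + q \<le> (r + 1) / 2 \<longrightarrow> T \<le> c * \<epsilon> powr (- (p + q - 1))) \<and>
      ((r + 1) / 2 \<le> p + q \<longrightarrow> T \<le> c * \<epsilon> powr (- (r - 1) / 2)) \<longrightarrow>
      (\<exists>u. classical_solution p q r A B f g \<epsilon> T u))"
proof -
  define m where "m = min (p + q) ((r + 1) / 2)"
  have "m \<le> (r + 1) / 2" unfolding m_def by (rule min.cobounded2)
  then have "2 * m - 1 \<le> r" by (simp add: field_simps)
  moreover have "1 < m" "m \<le> p + q" using assms(1-3) by (auto simp: m_def)
  ultimately obtain c where c: "0 < c" and ex: "\<And>\<epsilon> T. 0 < \<epsilon> \<Longrightarrow> \<epsilon> \<le> 1 \<Longrightarrow> 0 < T \<Longrightarrow>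
      T \<le> c * \<epsilon> powr (1 - m) \<Longrightarrow> \<exists>u. classical_solution p q r A B f g \<epsilon> T u"
    using existence_up_to_lifespan[of p q r A B R f g m] assms by auto
  have "T \<le> c * \<epsilon> powr (1 - m)"
    if "p + q \<le> (r + 1) / 2 \<longrightarrow> T \<le> c * \<epsilon> powr (- (p + q - 1))"
      "(r + 1) / 2 \<le> p + q \<longrightarrow> T \<le> c * \<epsilon> powr (- (r - 1) / 2)" for \<epsilon> T
  proof (cases "p + q \<le> (r + 1) / 2")
    case True
    then have "1 - m = - (p + q - 1)" by (simp add: m_def)
    with that(1) True show ?thesis by (simp only: simp_thms)
  next
    case False
    then have m_eq: "1 - m = - (r - 1) / 2" by (simp add: m_def min_def field_simps)
    from that(2) False show ?thesis unfolding m_eq by simp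
  qed
  with ex have "\<forall>\<epsilon>. 0 < \<epsilon> \<and> \<epsilon> \<le> 1 \<longrightarrow> (\<forall>T > 0.
      (p + q \<le> (r + 1) / 2 \<longrightarrow> T \<le> c * \<epsilon> powr (- (p + q - 1))) \<and>
      ((r + 1) / 2 \<le> p + q \<longrightarrow> T \<le> c * \<epsilon> powr (- (r - 1) / 2)) \<longrightarrow>
      (\<exists>u. classical_solution p q r A B f g \<epsilon> T u))"
    by blast
  then show ?thesis using c zero_less_one by blast
qed

end
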